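(* There are constants $c>0$ and $d>0$ such that for all sufficiently large $n$, every $2^{2^{n/2}}$-bounded PCR/$\mathbb{Q}$ refutation of $Q_n$ that uses at most $2^{dn}$ distinct monomials has height at least $$2^{n/2-2}-\frac{cn+2\log n}{2^{n/2+2}}-1.$$
   Context: For $i\in[n]$, $j\in[2n]$ there are twin pairs $x_{ij},\bar x_{ij}$; $\mathrm{ks}_i=\sum_{j\in[2n]}x_{ij}-n$. $Q_n$ consists of: $\mathrm{ks}_1-1/2=0$; $\mathrm{ks}_i^2-\mathrm{ks}_{i+1}=0$ for $i\in[n-1]$; $\mathrm{ks}_n^2=0$. A PCR/$\mathbb{Q}$ proof from $Q$ is a sequence $p_1,\dots,p_\ell$ where each $p_i$ is in $Q$, a logical axiom $x^2-x$ or $x+\bar x-1$ for a twin pair, a product $xp_j$ ($j<i$, $x$ a variable), or $ap_j+bp_k$ ($j,k<i$, $a,b\in\mathbb{Q}$); a refutation ends with $1$. The height is the length of the longest path from a leaf to the last line in the proof DAG. It is $R$-bounded if all coefficients of all lines and all scalars $a,b$ have absolute value at most $R$. $\log$ is base 2. *)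

theory Defs
  imports Complex_Main "HOL-Library.Poly_Mapping"
begin

datatype var = X nat nat | Xbar nat nat

type_synonym mpoly = "(var \<Rightarrow>\<^sub>0 nat) \<Rightarrow>\<^sub>0 rat"

definition PVar :: "var \<Rightarrow> mpoly" where
  "PVar v = Poly_Mapping.single (Poly_Mapping.single v 1) 1"

definition PConst :: "rat \<Rightarrow> mpoly" where
  "PConst c = Poly_Mapping.single 0 c"

definition vars :: "nat \<Rightarrow> var set" where
  "vars n = {X i j | i j. i \<in> {1..n} \<and> j \<in> {1..2*n}}
          \<union> {Xbar i j | i j. i \<in> {1..n} \<and> j \<in> {1..2*n}}"

definition ks :: "nat \<Rightarrow> nat \<Rightarrow> mpoly" where
  "ks n i = (\<Sum>j\<in>{1..2*n}. PVar (X i j)) - PConst (of_nat n)"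

definition Qn :: "nat \<Rightarrow> mpoly set" where
  "Qn n = {ks n 1 - PConst (1/2)}
        \<union> {ks n i ^ 2 - ks n (i+1) | i. i \<in> {1..n-1}}
        \<union> {ks n n ^ 2}"

datatype rule =
    Axiom
  | Boolean var
  | Twin nat nat
  | Mult var nat
  | Lin rat nat rat nat

type_synonym pcr_proof = "(mpoly \<times> rule) list"

definition line_ok :: "nat \<Rightarrow> pcr_proof \<Rightarrow> nat \<Rightarrow> bool" where
  "line_ok n P i = (let p = fst (P ! i) in
     case snd (P ! i) of
       Axiom \<Rightarrow> p \<in> Qn n
     | Boolean v \<Rightarrow> v \<in> vars n \<and> p = PVar v ^ 2 - PVar v
     | Twin a b \<Rightarrow> X a b \<in> vars n \<and> p = PVar (X a b) + PVar (Xbar a b) - 1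
     | Mult v k \<Rightarrow> v \<in> vars n \<and> k < i \<and> p = PVar v * fst (P ! k)
     | Lin a k b l \<Rightarrow> k < i \<and> l < i \<and>
          p = PConst a * fst (P ! k) + PConst b * fst (P ! l))"

definition pcr_refutation :: "nat \<Rightarrow> pcr_proof \<Rightarrow> bool" where
  "pcr_refutation n P \<longleftrightarrow> P \<noteq> [] \<and> (\<forall>i < length P. line_ok n P i) \<and> fst (last P) = 1"

function line_height :: "pcr_proof \<Rightarrow> nat \<Rightarrow> nat" where
  "line_height P i = (case snd (P ! i) of
       Mult v k \<Rightarrow> (if k < i then line_height P k + 1 else 0)
     | Lin a k b l \<Rightarrow> (if k < i \<and> l < i then max (line_height P k) (line_height P l) + 1 else 0)
     | _ \<Rightarrow> 0)"
  by auto
termination by (relation "measure snd") auto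

definition height :: "pcr_proof \<Rightarrow> nat" where
  "height P = line_height P (length P - 1)"

definition scalars :: "rule \<Rightarrow> rat set" where
  "scalars r = (case r of Lin a k b l \<Rightarrow> {a, b} | _ \<Rightarrow> {})"

definition bounded :: "real \<Rightarrow> pcr_proof \<Rightarrow> bool" where
  "bounded R P \<longleftrightarrow> (\<forall>L \<in> set P.
      (\<forall>m. \<bar>real_of_rat (Poly_Mapping.lookup (fst L) m)\<bar> \<le> R) \<and>
      (\<forall>a \<in> scalars (snd L). \<bar>real_of_rat a\<bar> \<le> R))"

definition monomials :: "pcr_proof \<Rightarrow> (var \<Rightarrow>\<^sub>0 nat) set" where
  "monomials P = (\<Union>L \<in> set P. Poly_Mapping.keys (fst L))"

end

theory Submission
  imports Defs "HOL-Library.FuncSet"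
begin

text \<open>
  A restriction of each block of three consecutive variables of a row, leaving one variable free and
  setting the other two to 0 and 1, kills all monomials touching many blocks. On the free variables,
  the row sums behave under a signed measure \<open>E\<close> as if they were the non-integral numbers
  prescribed by the first equations, so against low-degree test functions all axioms vanish except
  \<open>ks n n ^ 2\<close>, which has the tiny value \<open>2 ^ - 2 ^ n\<close>. The size of a line
  is measured by its largest \<open>E\<close>-inner product with a cell (a conjunction of literals)
  having fewer than \<open>s\<close> literals per row. Linear combinations increase this size by a factor of at
  most \<open>2 * R\<close>. Multiplication by a literal can produce a cell with exactly \<open>s\<close> literals in
  a row; here a positive weighting of the \<open>2 ^ s\<close> cells on the same sites has vanishing alternating
  sum against low-degree functions, while two neighbouring cells add up to a smaller one, so the
  size increases by a factor of at most \<open>2 * s\<close>. Hence the line \<open>1\<close>, of size at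
  least 1, needs a large height.
\<close>

section \<open>Falling factorials and finite differences\<close>

definition ff :: "real \<Rightarrow> nat \<Rightarrow> real" where
  "ff x m = (\<Prod>j<m. x - real j)"

lemma ff_0 [simp]: "ff x 0 = 1"
  by (simp add: ff_def)

lemma ff_Suc: "ff x (Suc m) = ff x m * (x - real m)"
  by (simp add: ff_def)

lemma ff_add: "ff x (m + l) = ff x m * ff (x - real m) l"
  by (induction l) (simp_all add: ff_Suc algebra_simps)

lemma ff_pos: "real m < x + 1 \<Longrightarrow> 0 < ff x m"
  unfolding ff_def by (intro prod_pos) auto

lemma ff_nonneg: "real m \<le> x + 1 \<Longrightarrow> 0 \<le> ff x m"
  unfolding ff_def by (intro prod_nonneg) auto

lemma ff_of_nat_nonzero: "m \<le> N \<Longrightarrow> ff (real N) m \<noteq> 0"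
  using ff_pos[of m "real N"] by simp

text \<open>Toggling one element of \<open>F - A\<close> is a sign-reversing involution on the
  subsets of \<open>F\<close> that contain \<open>A\<close>.\<close>

lemma sum_alternating_supersets:
  assumes "finite F" "A \<subset> F"
  shows "(\<Sum>V\<in>Pow F. if A \<subseteq> V then (-1) ^ card V else (0::real)) = 0"
proof -
  obtain a where a: "a \<in> F" "a \<notin> A" using assms by auto
  define F' where "F' = F - {a}"
  have F: "F = insert a F'" "a \<notin> F'" "finite F'" using a assms by (auto simp: F'_def)
  let ?h = "\<lambda>V. if A \<subseteq> V then (-1) ^ card V else (0::real)"
  have "sum ?h (Pow F) = sum ?h (Pow F') + sum ?h (insert a ` Pow F')"
    using F by (subst F(1), subst Pow_insert, subst sum.union_disjoint) auto
  also have "sum ?h (insert a ` Pow F') = (\<Sum>V\<in>Pow F'. ?h (insert a V))"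
    using F by (subst sum.reindex) (auto simp: inj_on_def)
  also have "\<dots> = (\<Sum>V\<in>Pow F'. - ?h V)"
  proof (rule sum.cong)
    fix V assume "V \<in> Pow F'"
    then have "a \<notin> V" "finite V" using F finite_subset by auto
    then show "?h (insert a V) = - ?h V" using a by auto
  qed simp
  finally show ?thesis by (simp add: sum_negf)
qed

text \<open>Induction on the number of linear factors. On supersets of \<open>A\<close>, multiplying
  by \<open>card V\<close> amounts to summing over \<open>a\<close> in \<open>F\<close> with
  \<open>A\<close> replaced by \<open>insert a A\<close>. Each factor thus costs at most one element
  of \<open>F - A\<close>, and the cardinality bound keeps \<open>A\<close> a proper subset to the
  end.\<close>

lemma finite_difference_supersets:
  fixes c d :: "'b \<Rightarrow> real"
  assumes "finite L" "finite F" "A \<subseteq> F" "card A + card L < card F"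
  shows "(\<Sum>V\<in>Pow F. if A \<subseteq> V then (-1) ^ card V * (\<Prod>l\<in>L. c l + d l * real (card V)) else 0) = 0"
  using assms(1,3,4)
proof (induction L arbitrary: A rule: finite_induct)
  case empty
  then have "A \<subset> F" by auto
  then show ?case using sum_alternating_supersets[OF assms(2), of A] by (simp cong: if_cong)
next
  case (insert x L)
  let ?h = "\<lambda>A V. if A \<subseteq> V then (-1) ^ card V * (\<Prod>l\<in>L. c l + d l * real (card V)) else 0"
  have step: "(if A \<subseteq> V then (-1) ^ card V * (\<Prod>l\<in>insert x L. c l + d l * real (card V)) else 0)
      = c x * ?h A V + d x * (\<Sum>a\<in>F. ?h (insert a A) V)" if "V \<in> Pow F" for V
  proof (cases "A \<subseteq> V")
    case True
    have "(\<Sum>a\<in>F. ?h (insert a A) V) = (\<Sum>a\<in>F. if a \<in> V then ?h A V else 0)"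
      using True by (intro sum.cong) auto
    also have "\<dots> = (\<Sum>a\<in>V. ?h A V)"
      using that assms(2) by (subst sum.inter_restrict[symmetric]) (auto simp: Int_absorb1)
    finally have "(\<Sum>a\<in>F. ?h (insert a A) V) = real (card V) * ?h A V" by simp
    then show ?thesis using True insert by (simp add: algebra_simps)
  qed auto
  have z: "(\<Sum>V\<in>Pow F. ?h A V) = 0" using insert by auto
  have z': "(\<Sum>V\<in>Pow F. ?h (insert a A) V) = 0" if "a \<in> F" for a
  proof (rule insert.IH)
    show "insert a A \<subseteq> F" using that insert by auto
    have "card (insert a A) \<le> Suc (card A)" by (rule card_insert_le_m1) auto
    then show "card (insert a A) + card L < card F" using insert by simp
  qed
  have "(\<Sum>V\<in>Pow F. c x * ?h A V + d x * (\<Sum>a\<in>F. ?h (insert a A) V))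
     = c x * (\<Sum>V\<in>Pow F. ?h A V) + d x * (\<Sum>a\<in>F. \<Sum>V\<in>Pow F. ?h (insert a A) V)"
    by (subst sum.swap) (simp add: sum.distrib sum_distrib_left)
  then have e: "(\<Sum>V\<in>Pow F. c x * ?h A V + d x * (\<Sum>a\<in>F. ?h (insert a A) V)) = 0"
    using z z' by simp
  show ?case by (subst sum.cong[OF refl step]) (use e in auto)
qed

text \<open>In \<open>card V\<close> the product is a polynomial of degree at most
  \<open>p + q\<close>, so a finite difference of order \<open>card F\<close> annihilates it. The
  disjoint sum \<open>{..<p} <+> {..<q}\<close> indexes its linear factors.\<close>

corollary finite_difference_ff:
  assumes "finite F" "p + q < card F"
  shows "(\<Sum>V\<in>Pow F. (-1) ^ card V * (ff (x - real (card V)) p * ff (z + real (card V)) q)) = 0"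
proof -
  define c :: "nat + nat \<Rightarrow> real" where "c = case_sum (\<lambda>j. x - real j) (\<lambda>j. z - real j)"
  define d :: "nat + nat \<Rightarrow> real" where "d = case_sum (\<lambda>_. -1) (\<lambda>_. 1)"
  have "(\<Prod>l\<in>{..<p} <+> {..<q}. c l + d l * w) = ff (x - w) p * ff (z + w) q" for w
    by (simp add: prod.Plus c_def d_def ff_def algebra_simps)
  then show ?thesis
    using finite_difference_supersets[of "{..<p} <+> {..<q}" F "{}" c d] assms
    by (simp add: card_Plus)
qed

text \<open>\<open>phi t k p q\<close> interpolates to real \<open>k\<close> the probability that \<open>p\<close> given
  points lie in, and \<open>q\<close> others outside, a uniformly random \<open>k\<close>-subset of a \<open>t\<close>-set.\<close>
definition phi :: "nat \<Rightarrow> real \<Rightarrow> nat \<Rightarrow> nat \<Rightarrow> real" where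
  "phi t k p q = ff k p * ff (real t - k) q / ff (real t) (p + q)"

lemma phi_0_0 [simp]: "phi t k 0 0 = 1"
  by (simp add: phi_def)

lemma phi_Suc_left: "p + q < t \<Longrightarrow> (real t - real p - real q) * phi t k (Suc p) q = (k - real p) * phi t k p q"
  using ff_of_nat_nonzero[of "p + q" t] by (simp add: phi_def ff_Suc divide_simps)

lemma phi_Suc_right: "p + q < t \<Longrightarrow> (real t - real p - real q) * phi t k p (Suc q) = (real t - k - real q) * phi t k p q"
  using ff_of_nat_nonzero[of "p + q" t] by (simp add: phi_def ff_Suc divide_simps)

text \<open>The law of total probability for one more point, which lies inside or outside the random
  subset. With the denominator cleared it is
  \<open>(k - p) + (t - k - q) = t - p - q\<close>.\<close>

lemma phi_split: 
  assumes "p + q < t" 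
  shows "phi t k p q = phi t k (Suc p) q + phi t k p (Suc q)"
proof -
  have "(real t - real p - real q) * phi t k p q = (real t - real p - real q) * (phi t k (Suc p) q + phi t k p (Suc q))"
    using assms by (simp add: distrib_left phi_Suc_left phi_Suc_right) (simp add: algebra_simps)
  moreover have "real t - real p - real q \<noteq> 0" using assms by linarith
  ultimately show ?thesis by (metis mult_left_cancel)
qed

text \<open>The upper bound is by induction on the number of points: by \<open>phi_split\<close>,
  dropping a point adds a nonnegative term.\<close>

lemma phi_range:
  assumes "p + q \<le> t" "real p \<le> k" "real q \<le> real t - k"
  shows "0 \<le> phi t k p q \<and> phi t k p q \<le> 1"
  using assms
proof (induction "p + q" arbitrary: p q)
  case (Suc m)
  have nn: "0 \<le> phi t k p' q'" if "p' \<le> p" "q' \<le> q" for p' q'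
    unfolding phi_def using that Suc.prems
    by (intro divide_nonneg_nonneg mult_nonneg_nonneg ff_nonneg) auto
  consider p' where "p = Suc p'" | q' where "q = Suc q'" using Suc(2) by (cases p; cases q) auto
  then show ?case
  proof cases
    case 1
    have "phi t k p' q \<le> 1" using Suc.hyps(1)[of p' q] Suc.hyps(2) Suc.prems 1 by auto
    \<comment> \<open>\<open>Suc q\<close> may exceed the assumed bound on \<open>q\<close> by one;
      the unit of slack in \<open>ff_nonneg\<close> covers exactly this.\<close>
    moreover have "0 \<le> phi t k p' (Suc q)" 
      unfolding phi_def using 1 Suc.prems
      by (intro divide_nonneg_nonneg mult_nonneg_nonneg ff_nonneg) auto
    ultimately show ?thesis using phi_split[of p' q t k] nn[of p q] 1 Suc.prems by auto
  next
    case 2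
    have "phi t k p q' \<le> 1" using Suc.hyps(1)[of p q'] Suc.hyps(2) Suc.prems 2 by auto
    moreover have "0 \<le> phi t k (Suc p) q'" 
      unfolding phi_def using 2 Suc.prems
      by (intro divide_nonneg_nonneg mult_nonneg_nonneg ff_nonneg) auto
    ultimately show ?thesis using phi_split[of p q' t k] nn[of p q] 2 Suc.prems by auto
  qed
qed auto

section \<open>A signed measure with prescribed row sums\<close>

definition row_count :: "nat \<Rightarrow> (nat \<times> nat) set \<Rightarrow> nat" where
  "row_count i A = card {b. (i, b) \<in> A}"

lemma row_count_empty [simp]: "row_count i {} = 0"
  by (simp add: row_count_def)

lemma finite_row: "finite A \<Longrightarrow> finite {b. (i, b) \<in> A}"
  using finite_vimageI[of A "Pair i"] by (simp add: vimage_def inj_def)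

lemma row_count_mono: "finite B \<Longrightarrow> A \<subseteq> B \<Longrightarrow> row_count i A \<le> row_count i B"
  unfolding row_count_def by (rule card_mono[OF finite_row]) auto

lemma row_count_insert:
  assumes "finite A" "(i, b) \<notin> A"
  shows "row_count i' (insert (i, b) A) = (if i' = i then Suc (row_count i' A) else row_count i' A)"
proof -
  have "{b'. (i', b') \<in> insert (i, b) A} = (if i' = i then insert b {b'. (i', b') \<in> A} else {b'. (i', b') \<in> A})"
    by auto
  then show ?thesis using assms finite_row[OF assms(1)] by (simp add: row_count_def)
qed

lemma row_count_Un_disjoint:
  assumes "finite A" "finite B" "A \<inter> B = {}"
  shows "row_count i (A \<union> B) = row_count i A + row_count i B"
proof -
  have "{b. (i, b) \<in> A \<union> B} = {b. (i, b) \<in> A} \<union> {b. (i, b) \<in> B}" by auto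
  then show ?thesis using assms finite_row[of _ i] unfolding row_count_def
    by (subst card_Un_disjoint[symmetric]) auto
qed

lemma row_count_le_card: "finite A \<Longrightarrow> row_count i A \<le> card A"
  unfolding row_count_def
  by (rule card_inj_on_le[where f = "Pair i"]) (auto simp: inj_on_def)

lemma row_count_within_row: 
  assumes "S \<subseteq> {i} \<times> UNIV" shows "row_count i S = card S"
proof -
  have "Pair i ` {b. (i, b) \<in> S} = S" using assms by auto
  moreover have "card (Pair i ` {b. (i, b) \<in> S}) = card {b. (i, b) \<in> S}"
    by (intro card_image) (simp add: inj_on_def)
  ultimately show ?thesis by (simp add: row_count_def)
qed

section \<open>Cells and their expectations\<close>

definition cell :: "'a set \<Rightarrow> 'a set \<Rightarrow> 'a set \<Rightarrow> real" where
  "cell P Q y = of_bool (P \<subseteq> y \<and> Q \<inter> y = {})"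

lemma cell_empty [simp]: "cell {} {} y = 1"
  by (simp add: cell_def)

lemma cell_mult: "cell P Q y * cell P' Q' y = cell (P \<union> P') (Q \<union> Q') y"
  by (auto simp: cell_def of_bool_def)

lemma cell_overlap: "P \<inter> Q \<noteq> {} \<Longrightarrow> cell P Q y = 0"
  by (auto simp: cell_def)

lemma cell_split: "cell P Q y = cell (insert e P) Q y + cell P (insert e Q) y"
  by (auto simp: cell_def)

locale pseudo_distribution =
  fixes n t :: nat and k :: "nat \<Rightarrow> real"
begin

definition sites :: "(nat \<times> nat) set" where
  "sites = {1..n} \<times> {..<t}"

definition weight :: "(nat \<times> nat) set \<Rightarrow> (nat \<times> nat) set \<Rightarrow> real" where
  "weight P Q = (\<Prod>i\<in>{1..n}. phi t (k i) (row_count i P) (row_count i Q))"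

text \<open>Expectation under a product over rows of interpolated uniform
  \<open>k i\<close>-subsets. For non-integral \<open>k i\<close> single assignments may have
  negative weight; only marginals on few sites are ordinary probabilities.\<close>

definition E :: "((nat \<times> nat) set \<Rightarrow> real) \<Rightarrow> real" where
  "E f = (\<Sum>y\<in>Pow sites. weight y (sites - y) * f y)"

lemma finite_sites [simp]: "finite sites"
  by (simp add: sites_def)

lemma finite_subset_sites: "A \<subseteq> sites \<Longrightarrow> finite A"
  by (rule finite_subset[OF _ finite_sites])

lemma E_cong: "(\<And>y. y \<subseteq> sites \<Longrightarrow> f y = g y) \<Longrightarrow> E f = E g"
  unfolding E_def by (rule sum.cong) auto

lemma E_add: "E (\<lambda>y. f y + g y) = E f + E g"
  by (simp add: E_def algebra_simps sum.distrib)

lemma E_cmult: "E (\<lambda>y. c * f y) = c * E f"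
  by (simp add: E_def algebra_simps sum_distrib_left)

lemma E_sum: "E (\<lambda>y. \<Sum>a\<in>A. f a y) = (\<Sum>a\<in>A. E (f a))"
  unfolding E_def by (subst sum.swap) (simp add: sum_distrib_left)

lemma E_0 [simp]: "E (\<lambda>y. 0) = 0"
  by (simp add: E_def)

lemma row_count_le: 
  assumes "A \<subseteq> sites" shows "row_count i A \<le> t"
proof -
  have "{b. (i, b) \<in> A} \<subseteq> {..<t}" using assms by (auto simp: sites_def)
  then have "card {b. (i, b) \<in> A} \<le> card {..<t}" by (intro card_mono) auto
  then show ?thesis by (simp add: row_count_def)
qed

lemma weight_split:
  assumes "P \<subseteq> sites" "Q \<subseteq> sites" "P \<inter> Q = {}" "e \<in> sites" "e \<notin> P \<union> Q"
  shows "weight P Q = weight (insert e P) Q + weight P (insert e Q)"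
proof -
  obtain i b where e: "e = (i, b)" by fastforce
  have i: "i \<in> {1..n}" using assms e by (auto simp: sites_def)
  have fin: "finite P" "finite Q" using assms finite_subset_sites by auto
  have "row_count i (insert e (P \<union> Q)) \<le> t" using assms by (intro row_count_le) auto
  then have lt: "row_count i P + row_count i Q < t"
    using row_count_insert[of "P \<union> Q" i b i] assms e fin by (simp add: row_count_Un_disjoint)
  let ?R = "\<Prod>j\<in>{1..n}-{i}. phi t (k j) (row_count j P) (row_count j Q)"
  have 1: "weight P Q = phi t (k i) (row_count i P) (row_count i Q) * ?R"
    unfolding weight_def using i by (subst prod.remove[of _ i]) auto
  have 2: "weight (insert e P) Q = phi t (k i) (Suc (row_count i P)) (row_count i Q) * ?R"
    unfolding weight_def using i assms e fin
    by (subst prod.remove[of _ i]) (auto simp: row_count_insert intro!: prod.cong)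
  have 3: "weight P (insert e Q) = phi t (k i) (row_count i P) (Suc (row_count i Q)) * ?R"
    unfolding weight_def using i assms e fin
    by (subst prod.remove[of _ i]) (auto simp: row_count_insert intro!: prod.cong)
  show ?thesis unfolding 1 2 3 using phi_split[OF lt] by (simp add: algebra_simps)
qed

text \<open>Splitting on the undetermined sites one at a time reduces to a cell that fixes every
  site, where only \<open>y = P\<close> contributes; \<open>weight_split\<close> says that the
  marginals are consistent.\<close>

lemma E_cell:
  assumes "P \<subseteq> sites" "Q \<subseteq> sites" "P \<inter> Q = {}"
  shows "E (cell P Q) = weight P Q"
  using assms
proof (induction "card (sites - (P \<union> Q))" arbitrary: P Q)
  case 0
  then have Q: "Q = sites - P" by auto
  have "E (cell P Q) = (\<Sum>y\<in>Pow sites. if y = P then weight P Q else 0)"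
    unfolding E_def using Q 0 by (intro sum.cong) (auto simp: cell_def)
  then show ?case using 0 by simp
next
  case (Suc m)
  have "sites - (P \<union> Q) \<noteq> {}" using Suc(2) by (metis card.empty nat.distinct(1))
  then obtain e where e: "e \<in> sites" "e \<notin> P \<union> Q" by auto
  have "card (sites - (insert e P \<union> Q)) = m" "card (sites - (P \<union> insert e Q)) = m"
    using Suc(2) e card_Diff_singleton[of e "sites - (P \<union> Q)"]
    by (simp_all add: Diff_insert[of sites e "P \<union> Q"])
  then have "E (cell (insert e P) Q) = weight (insert e P) Q" "E (cell P (insert e Q)) = weight P (insert e Q)"
    using e Suc.prems by (intro Suc.hyps(1); force)+
  moreover have "E (cell P Q) = E (cell (insert e P) Q) + E (cell P (insert e Q))"
    by (subst E_add[symmetric]) (rule E_cong, rule cell_split)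
  ultimately show ?case using weight_split[of P Q e] Suc e by simp
qed

lemma E_1:
  "E (\<lambda>y. 1) = 1"
proof -
  have "E (\<lambda>y. 1) = E (cell {} {})" by (rule E_cong) simp
  then show ?thesis using E_cell[of "{}" "{}"] by (simp add: weight_def)
qed

lemma row_count_eq_sum: 
  assumes "y \<subseteq> sites" 
  shows "real (row_count i y) = (\<Sum>b<t. of_bool ((i, b) \<in> y))"
proof -
  have "{b. (i, b) \<in> y} = {..<t} \<inter> {b. (i, b) \<in> y}" using assms by (auto simp: sites_def)
  then have "real (row_count i y) = (\<Sum>b\<in>{..<t} \<inter> {b. (i, b) \<in> y}. 1)" by (simp add: row_count_def)
  then show ?thesis by (subst (asm) sum.inter_restrict) (auto simp: of_bool_def)
qed

lemma cell_row_count: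
  assumes "y \<subseteq> sites"
  shows "cell P Q y * real (row_count i y) = (\<Sum>b<t. cell (insert (i, b) P) Q y)"
  unfolding row_count_eq_sum[OF assms] sum_distrib_left
  by (rule sum.cong) (auto simp: cell_def of_bool_def)

text \<open>Sum over the sites of row \<open>i\<close>: one in \<open>P\<close> repeats the cell,
  one in \<open>Q\<close> kills it, all others give equal mass. By \<open>phi_Suc_left\<close> the
  others contribute \<open>k i - ?p\<close> times the mass, and the \<open>?p\<close> repeats
  complete this to \<open>k i\<close>.\<close>

lemma E_cell_row_count:
  assumes "P \<subseteq> sites" "Q \<subseteq> sites" "i \<in> {1..n}" "row_count i (P \<union> Q) < t"
  shows "E (\<lambda>y. cell P Q y * real (row_count i y)) = k i * E (cell P Q)"
proof (cases "P \<inter> Q = {}")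
  case False
  then show ?thesis by (simp add: cell_overlap E_def)
next
  case True
  have fin: "finite P" "finite Q" using assms finite_subset_sites by auto
  let ?p = "row_count i P" and ?q = "row_count i Q"
  have lt: "?p + ?q < t" using assms fin True by (simp add: row_count_Un_disjoint)
  let ?R = "\<Prod>j\<in>{1..n}-{i}. phi t (k j) (row_count j P) (row_count j Q)"
  have W: "weight P Q = phi t (k i) ?p ?q * ?R"
    unfolding weight_def using assms by (subst prod.remove[of _ i]) auto
  define PB QB where "PB = {b. (i, b) \<in> P}" and "QB = {b. (i, b) \<in> Q}"
  have PB: "PB \<subseteq> {..<t}" "QB \<subseteq> {..<t}" "PB \<inter> QB = {}" "card PB = ?p" "card QB = ?q"
    using assms True by (auto simp: PB_def QB_def sites_def row_count_def)
  then have disj: "b \<notin> PB" if "b \<in> QB" for b using that by blast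
  have finPB: "finite PB" "finite QB" using PB finite_subset[of _ "{..<t}"] by auto
  have W': "weight (insert (i, b) P) Q = phi t (k i) (Suc ?p) ?q * ?R" if "b \<notin> PB" for b
    unfolding weight_def using assms fin that
    by (subst prod.remove[of _ i]) (auto simp: row_count_insert PB_def intro!: prod.cong)
  have site: "E (cell (insert (i, b) P) Q) = (if b \<in> PB then weight P Q
      else if b \<in> QB then 0 else phi t (k i) (Suc ?p) ?q * ?R)" if "b < t" for b
  proof -
    consider "b \<in> PB" | "b \<notin> PB" "b \<in> QB" | "b \<notin> PB" "b \<notin> QB" by blast
    then show ?thesis
    proof cases
      case 1
      then have "insert (i, b) P = P" by (auto simp: PB_def)
      then show ?thesis using 1 E_cell[OF assms(1,2) True] by simp
    next
      case 2
      then have "insert (i, b) P \<inter> Q \<noteq> {}" by (auto simp: QB_def)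
      then show ?thesis using 2 by (simp add: cell_overlap E_def)
    next
      case 3
      then have "E (cell (insert (i, b) P) Q) = weight (insert (i, b) P) Q"
        using assms True that by (intro E_cell) (auto simp: sites_def QB_def)
      then show ?thesis using 3 W' by simp
    qed
  qed
  have "E (\<lambda>y. cell P Q y * real (row_count i y)) = E (\<lambda>y. \<Sum>b<t. cell (insert (i, b) P) Q y)"
    by (rule E_cong) (rule cell_row_count)
  also have "\<dots> = (\<Sum>b<t. E (cell (insert (i, b) P) Q))" by (rule E_sum)
  also have "\<dots> = (\<Sum>b\<in>PB \<union> QB \<union> ({..<t} - PB - QB). E (cell (insert (i, b) P) Q))"
    using PB by (intro sum.cong) auto
  also have "\<dots> = (\<Sum>b\<in>PB. E (cell (insert (i, b) P) Q)) + (\<Sum>b\<in>QB. E (cell (insert (i, b) P) Q))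
       + (\<Sum>b\<in>{..<t} - PB - QB. E (cell (insert (i, b) P) Q))"
    using PB finPB by (subst sum.union_disjoint; (subst sum.union_disjoint)?) auto
  also have "(\<Sum>b\<in>PB. E (cell (insert (i, b) P) Q)) = (\<Sum>b\<in>PB. weight P Q)"
    using PB site by (intro sum.cong) auto
  also have "(\<Sum>b\<in>QB. E (cell (insert (i, b) P) Q)) = (\<Sum>b\<in>QB. 0)"
    using PB(1,2) disj site by (intro sum.cong) auto
  also have "(\<Sum>b\<in>{..<t} - PB - QB. E (cell (insert (i, b) P) Q))
      = (\<Sum>b\<in>{..<t} - PB - QB. phi t (k i) (Suc ?p) ?q * ?R)"
    using PB site by (intro sum.cong) auto
  also have "\<dots> = (real t - real ?p - real ?q) * phi t (k i) (Suc ?p) ?q * ?R"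
  proof -
    have "card ({..<t} - PB - QB) = t - ?p - ?q"
      using PB finPB by (subst card_Diff_subset; (subst card_Diff_subset)?) auto
    then show ?thesis using lt by (simp add: of_nat_diff)
  qed
  also have "\<dots> = (k i - real ?p) * weight P Q" 
    by (simp only: phi_Suc_left[OF lt] W mult.assoc[symmetric])
  finally show ?thesis using E_cell[OF assms(1,2) True] PB by (simp add: algebra_simps)
qed

text \<open>One factor is expanded into cells with an additional literal in row \<open>i\<close>,
  and the linear case is applied twice; hence the room for one more literal in the
  hypothesis.\<close>

lemma E_cell_row_count_square:
  assumes "P \<subseteq> sites" "Q \<subseteq> sites" "i \<in> {1..n}" "Suc (row_count i (P \<union> Q)) < t"
  shows "E (\<lambda>y. cell P Q y * (real (row_count i y))\<^sup>2) = (k i)\<^sup>2 * E (cell P Q)"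
proof -
  have fin: "finite P" "finite Q" using assms finite_subset_sites by auto
  have "E (\<lambda>y. cell P Q y * (real (row_count i y))\<^sup>2)
      = E (\<lambda>y. \<Sum>b<t. cell (insert (i, b) P) Q y * real (row_count i y))"
  proof (rule E_cong)
    fix y assume "y \<subseteq> sites"
    then show "cell P Q y * (real (row_count i y))\<^sup>2 = (\<Sum>b<t. cell (insert (i, b) P) Q y * real (row_count i y))"
      by (simp only: power2_eq_square mult.assoc[symmetric] cell_row_count sum_distrib_right)
  qed
  also have "\<dots> = (\<Sum>b<t. k i * E (cell (insert (i, b) P) Q))"
    unfolding E_sum
  proof (rule sum.cong)
    fix b assume "b \<in> {..<t}"
    moreover have "row_count i (insert (i, b) P \<union> Q) \<le> Suc (row_count i (P \<union> Q))"
      using row_count_insert[of "P \<union> Q" i b i] fin by (cases "(i, b) \<in> P \<union> Q") (auto simp: insert_absorb)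
    ultimately show "E (\<lambda>y. cell (insert (i, b) P) Q y * real (row_count i y)) = k i * E (cell (insert (i, b) P) Q)"
      using assms by (intro E_cell_row_count) (auto simp: sites_def)
  qed simp
  also have "\<dots> = k i * E (\<lambda>y. cell P Q y * real (row_count i y))"
  proof -
    have "E (\<lambda>y. cell P Q y * real (row_count i y)) = E (\<lambda>y. \<Sum>b<t. cell (insert (i, b) P) Q y)"
      by (rule E_cong) (rule cell_row_count)
    then show ?thesis by (simp only: E_sum sum_distrib_left)
  qed
  finally show ?thesis using E_cell_row_count assms by (simp add: power2_eq_square)
qed

lemma weight_range:
  assumes "\<And>i. i \<in> {1..n} \<Longrightarrow> real (row_count i P) \<le> k i \<and> real (row_count i Q) \<le> real t - k i
             \<and> row_count i P + row_count i Q \<le> t"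
  shows "0 \<le> weight P Q \<and> weight P Q \<le> 1"
proof -
  have "0 \<le> phi t (k i) (row_count i P) (row_count i Q) \<and> phi t (k i) (row_count i P) (row_count i Q) \<le> 1"
    if "i \<in> {1..n}" for i
    using assms[OF that] by (intro phi_range) auto
  then show ?thesis unfolding weight_def by (intro conjI prod_nonneg prod_le_1) auto
qed

end

section \<open>Cells with many literals in a row\<close>

text \<open>The first two factors on the left complete the falling factorials to length
  \<open>s\<close>. What then depends on \<open>w\<close> is a product of only \<open>p + q\<close>
  linear factors, ready for \<open>finite_difference_ff\<close>.\<close>

lemma ff_exchange:
  assumes "w \<le> s"
  shows "ff (T - real s + real w) w * ff (k - real w) (s - w) * (ff k (w + p) * ff T (s - w + q))
       = ff k s * ff T s * (ff (k - real w) p * ff (T - real s + real w) q)"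
proof -
  have "ff k s = ff k w * ff (k - real w) (s - w)"
    using ff_add[of k w "s - w"] assms by simp
  moreover have "ff T s = ff T (s - w) * ff (T - real s + real w) w"
    using ff_add[of T "s - w" w] assms by (simp add: of_nat_diff algebra_simps)
  moreover have "ff T (s - w + q) = ff T (s - w) * ff (T - real s + real w) q"
    using ff_add[of T "s - w" q] assms by (simp add: of_nat_diff algebra_simps)
  ultimately show ?thesis by (simp add: ff_add)
qed

text \<open>By \<open>step\<close>, \<open>(-1) ^ card V * e V\<close> is almost constant, and by \<open>balance\<close> its weighted mean is 0.\<close>
lemma alternating_balance:
  fixes e g :: "'a set \<Rightarrow> real"
  assumes "finite S" "V0 \<subseteq> S" "0 \<le> B"
    and pos: "\<And>V. V \<subseteq> S \<Longrightarrow> 0 < g V"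
    and balance: "(\<Sum>V\<in>Pow S. (-1) ^ card V * g V * e V) = 0"
    and step: "\<And>V a. V \<subseteq> S \<Longrightarrow> a \<in> S - V \<Longrightarrow> \<bar>e V + e (insert a V)\<bar> \<le> B"
  shows "\<bar>e V0\<bar> \<le> 2 * real (card S) * B"
proof -
  define u where "u V = (-1) ^ card V * e V" for V
  have abs_u: "\<bar>u V\<bar> = \<bar>e V\<bar>" for V by (simp add: u_def abs_mult power_abs)
  \<comment> \<open>Build \<open>V\<close> up from the empty set; each added element moves the
    sign-corrected value \<open>u\<close> by at most \<open>B\<close>.\<close>
  have near_empty: "\<bar>u V - u {}\<bar> \<le> real (card V) * B" if "V \<subseteq> S" for V
    using finite_subset[OF that assms(1)] that
  proof (induction V rule: finite_induct)
    case (insert a V)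
    have "u (insert a V) - u V = - ((-1) ^ card V) * (e V + e (insert a V))"
      using insert by (simp add: u_def algebra_simps)
    then have "\<bar>u (insert a V) - u V\<bar> = \<bar>e V + e (insert a V)\<bar>"
      by (simp add: abs_mult power_abs)
    also have "\<dots> \<le> B" using insert by (intro step) auto
    finally show ?case using insert by (simp add: algebra_simps)
  qed simp
  have near: "\<bar>u V0 - u V\<bar> \<le> 2 * real (card S) * B" if "V \<subseteq> S" for V
  proof -
    have "real (card V) * B \<le> real (card S) * B" "real (card V0) * B \<le> real (card S) * B"
      using that assms by (auto intro!: mult_right_mono card_mono)
    then show ?thesis using near_empty[OF that] near_empty[OF assms(2)] by linarith
  qed
  define G where "G = (\<Sum>V\<in>Pow S. g V)"
  have "0 < G" unfolding G_def using assms by (intro sum_pos) auto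
  \<comment> \<open>The weighted sum of \<open>u\<close> is zero, so subtracting it turns
    \<open>u V0\<close> into a weighted mean of differences.\<close>
  have "G * u V0 = (\<Sum>V\<in>Pow S. g V * u V0) - (\<Sum>V\<in>Pow S. g V * u V)"
  proof -
    have "(\<Sum>V\<in>Pow S. g V * u V) = 0" using balance by (simp add: u_def mult_ac)
    then show ?thesis by (simp add: G_def sum_distrib_right)
  qed
  also have "\<dots> = (\<Sum>V\<in>Pow S. g V * (u V0 - u V))"
    by (simp add: sum_subtractf right_diff_distrib)
  finally have "\<bar>G * u V0\<bar> \<le> (\<Sum>V\<in>Pow S. \<bar>g V * (u V0 - u V)\<bar>)" by simp
  also have "\<dots> \<le> (\<Sum>V\<in>Pow S. g V * (2 * real (card S) * B))"
    using near by (intro sum_mono) (auto simp: abs_mult abs_of_pos[OF pos] intro!: mult_left_mono less_imp_le[OF pos])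
  also have "\<dots> = G * (2 * real (card S) * B)" by (simp add: G_def sum_distrib_right)
  finally show ?thesis using \<open>0 < G\<close> abs_u by (simp add: abs_mult)
qed

section \<open>The balancing relation and the growth of controlled functions\<close>

context pseudo_distribution
begin

text \<open>The cofactor from \<open>ff_exchange\<close> with \<open>T = t - k i\<close>, where
  \<open>w\<close> of the \<open>s\<close> chosen sites are positive.\<close>

definition balance :: "nat \<Rightarrow> nat \<Rightarrow> nat \<Rightarrow> real" where
  "balance i s w = ff (real t - k i - real s + real w) w * ff (k i - real w) (s - w)"

lemma balance_pos:
  assumes "w \<le> s" "real s < k i + 1" "real s < real t - k i + 1"
  shows "0 < balance i s w"
  unfolding balance_def using assms by (intro mult_pos_pos ff_pos) (auto simp: of_nat_diff)

text \<open>The weighted mass of a compatible cell is a constant times a polynomial in the number of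
  freely chosen positive sites, of degree below the number of free sites, so its alternating sum
  vanishes.\<close>

lemma balance_relation:
  assumes S: "S \<subseteq> {i} \<times> {..<t}" and i: "i \<in> {1..n}" and PQ: "P \<subseteq> sites" "Q \<subseteq> sites"
    and lt: "row_count i (P \<union> Q) < card S"
  shows "(\<Sum>V\<in>Pow S. (-1) ^ card V * balance i (card S) (card V) * E (cell (V \<union> P) (S - V \<union> Q))) = 0"
proof (cases "P \<inter> Q = {}")
  case False
  then have "E (cell (V \<union> P) (S - V \<union> Q)) = 0" for V
    by (simp add: E_def, subst cell_overlap) auto
  then show ?thesis by simp
next
  case True
  have Ssites: "S \<subseteq> sites" using S i by (auto simp: sites_def)
  have fin: "finite S" "finite P" "finite Q" using Ssites PQ finite_subset_sites by auto
  define s where "s = card S"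
  \<comment> \<open>Compatibility with \<open>P\<close> and \<open>Q\<close> forces \<open>A\<close>
    into \<open>V\<close> and leaves exactly the sites in \<open>F\<close> free.\<close>
  define A F where "A = P \<inter> S" and "F = S - P - Q"
  define p q where "p = row_count i (P - S)" and "q = row_count i (Q - S)"
  have row: "row_count i V = card V" if "V \<subseteq> S" for V
    using that S by (intro row_count_within_row) auto
  have FA: "finite F" "finite A" "A \<inter> F = {}" "A \<subseteq> S" "F \<subseteq> S" using fin by (auto simp: A_def F_def)
  have "card F + card ((P \<union> Q) \<inter> S) = s"
    unfolding s_def F_def using fin by (subst card_Un_disjoint[symmetric]) (auto intro!: arg_cong[of _ _ card])
  moreover have "row_count i (P \<union> Q) = card ((P \<union> Q) \<inter> S) + p + q"
  proof -
    have "P \<union> Q = ((P \<union> Q) \<inter> S) \<union> ((P - S) \<union> (Q - S))" by auto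
    then have "row_count i (P \<union> Q) = row_count i (((P \<union> Q) \<inter> S) \<union> ((P - S) \<union> (Q - S)))" by simp
    also have "\<dots> = row_count i ((P \<union> Q) \<inter> S) + (p + q)"
      unfolding p_def q_def using fin True by (subst row_count_Un_disjoint; (subst row_count_Un_disjoint)?) auto
    finally show ?thesis using row[of "(P \<union> Q) \<inter> S"] by simp
  qed
  \<comment> \<open>Both \<open>card S\<close> and the row count contain the sites of
    \<open>S\<close> fixed by \<open>P\<close> or \<open>Q\<close>; cancelling them leaves the
    literals off \<open>S\<close> on one side and the free sites on the other.\<close>
  ultimately have pq: "p + q < card F" using lt s_def by linarith
  define R where "R = (\<Prod>j\<in>{1..n}-{i}. phi t (k j) (row_count j P) (row_count j Q))"
  \<comment> \<open>Everything independent of the free choice \<open>F'\<close>: completed falling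
    factorials, the other rows and the sign of \<open>A\<close>.\<close>
  define c where "c = ff (k i) s * ff (real t - k i) s / ff (real t) (s + p + q) * R * (-1) ^ card A"
  define h where "h V = (-1) ^ card V * balance i s (card V) * E (cell (V \<union> P) (S - V \<union> Q))" for V
  have zero: "h V = 0" if "V \<in> Pow S - (\<union>) A ` Pow F" for V
  proof -
    have "\<not> (A \<subseteq> V \<and> V \<inter> Q = {})"
    proof
      assume "A \<subseteq> V \<and> V \<inter> Q = {}"
      then have "V = A \<union> (V - A)" "V - A \<in> Pow F" using that by (auto simp: A_def F_def)
      then show False using that by blast
    qed
    then have "(V \<union> P) \<inter> (S - V \<union> Q) \<noteq> {}" by (auto simp: A_def)
    then show ?thesis by (simp add: h_def E_def cell_overlap)
  qed
  have compatible: "h (A \<union> F') = c * ((-1) ^ card F' * (ff ((k i - real (card A)) - real (card F')) p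
      * ff ((real t - k i - real s + real (card A)) + real (card F')) q))" if F': "F' \<subseteq> F" for F'
  proof -
    define V where "V = A \<union> F'"
    have V: "V \<subseteq> S" "V \<inter> Q = {}" "P \<inter> S \<subseteq> V" using F' True by (auto simp: V_def A_def F_def)
    have cV: "card V = card A + card F'"
      unfolding V_def using FA F' by (intro card_Un_disjoint) (auto intro: finite_subset)
    have ws: "card V \<le> s" using V fin by (auto simp: s_def intro: card_mono)
    have finV: "finite V" using V(1) fin(1) by (rule finite_subset)
    have "V \<union> P = V \<union> (P - S)" using V by auto
    then have rP: "row_count i (V \<union> P) = card V + p"
      using V fin finV row[of V] row_count_Un_disjoint[of V "P - S" i] by (auto simp: p_def)
    have "S - V \<union> Q = (S - V) \<union> (Q - S)" using V by auto
    then have rQ: "row_count i (S - V \<union> Q) = s - card V + q"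
      using V fin finV row[of "S - V"] row_count_Un_disjoint[of "S - V" "Q - S" i]
      by (auto simp: q_def s_def card_Diff_subset)
    have others: "row_count j (V \<union> P) = row_count j P" "row_count j (S - V \<union> Q) = row_count j Q" 
      if "j \<noteq> i" for j
      unfolding row_count_def using that V(1) S by (auto intro!: arg_cong[of _ _ card])
    have "E (cell (V \<union> P) (S - V \<union> Q)) = weight (V \<union> P) (S - V \<union> Q)"
      using V Ssites PQ True by (intro E_cell) auto
    also have "\<dots> = phi t (k i) (card V + p) (s - card V + q) * R"
      unfolding weight_def R_def using i rP rQ others
      by (subst prod.remove[of _ i]) (auto intro!: prod.cong)
    also have "\<dots> = ff (k i) (card V + p) * ff (real t - k i) (s - card V + q) / ff (real t) (s + p + q) * R"
      using ws by (simp add: phi_def algebra_simps)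
    finally have "balance i s (card V) * E (cell (V \<union> P) (S - V \<union> Q))
      = (ff (real t - k i - real s + real (card V)) (card V) * ff (k i - real (card V)) (s - card V)
         * (ff (k i) (card V + p) * ff (real t - k i) (s - card V + q))) / ff (real t) (s + p + q) * R"
      by (simp add: balance_def)
    also have "\<dots> = (ff (k i) s * ff (real t - k i) s * (ff (k i - real (card V)) p * ff (real t - k i - real s + real (card V)) q))
         / ff (real t) (s + p + q) * R"
      unfolding ff_exchange[OF ws] ..
    finally have "h V = (-1) ^ card V * \<dots>" by (simp add: h_def mult.assoc)
    then show ?thesis unfolding V_def[symmetric] unfolding cV c_def
      by (simp add: power_add algebra_simps)
  qed
  have "(\<Sum>V\<in>Pow S. h V) = (\<Sum>V\<in>(\<union>) A ` Pow F. h V)"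
    using fin FA zero by (intro sum.mono_neutral_right) auto
  also have "\<dots> = (\<Sum>F'\<in>Pow F. h (A \<union> F'))"
    using FA by (subst sum.reindex) (auto simp: inj_on_def)
  also have "\<dots> = c * (\<Sum>F'\<in>Pow F. (-1) ^ card F' * (ff ((k i - real (card A)) - real (card F')) p
      * ff ((real t - k i - real s + real (card A)) + real (card F')) q))"
    using compatible by (simp add: sum_distrib_left)
  also have "\<dots> = 0" using finite_difference_ff[OF FA(1) pq] by simp
  finally show ?thesis unfolding h_def s_def .
qed

text \<open>The linear span of the cells with fewer than \<open>s\<close> literals. The bound counts
  literals over all rows together.\<close>

inductive low :: "nat \<Rightarrow> ((nat \<times> nat) set \<Rightarrow> real) \<Rightarrow> bool" for s where
  low_cell: "P \<subseteq> sites \<Longrightarrow> Q \<subseteq> sites \<Longrightarrow> card (P \<union> Q) < s \<Longrightarrow> low s (cell P Q)"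
| low_zero: "low s (\<lambda>y. 0)"
| low_add: "low s f \<Longrightarrow> low s g \<Longrightarrow> low s (\<lambda>y. f y + g y)"
| low_scale: "low s f \<Longrightarrow> low s (\<lambda>y. c * f y)"

lemma low_sum: "(\<And>a. a \<in> A \<Longrightarrow> low s (f a)) \<Longrightarrow> low s (\<lambda>y. \<Sum>a\<in>A. f a y)"
  by (induction A rule: infinite_finite_induct) (auto intro: low_zero low_add)

text \<open>By linearity \<open>f\<close> may be a cell. Since \<open>P\<close> and \<open>Q\<close>
  avoid row \<open>i\<close>, its fewer than \<open>card S\<close> literals are all that
  \<open>balance_relation\<close> meets there.\<close>

lemma balance_relation_low:
  assumes "low (card S) f" and S: "S \<subseteq> {i} \<times> {..<t}" and i: "i \<in> {1..n}" 
    and PQ: "P \<subseteq> sites" "Q \<subseteq> sites" "row_count i (P \<union> Q) = 0"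
  shows "(\<Sum>V\<in>Pow S. (-1) ^ card V * balance i (card S) (card V) * E (\<lambda>y. cell (V \<union> P) (S - V \<union> Q) y * f y)) = 0"
  using assms(1)
proof induction
  case (low_cell P' Q')
  have fin: "finite P" "finite Q" "finite P'" "finite Q'" using PQ low_cell finite_subset_sites by auto
  have "{b. (i, b) \<in> P \<union> Q} = {}" 
    using PQ(3) fin finite_row[of "P \<union> Q" i] by (simp add: row_count_def)
  then have "row_count i ((P \<union> P') \<union> (Q \<union> Q')) = row_count i (P' \<union> Q')"
    unfolding row_count_def by (auto intro!: arg_cong[of _ _ card])
  also have "\<dots> < card S" using low_cell fin row_count_le_card[of "P' \<union> Q'" i] by simp
  finally have "row_count i ((P \<union> P') \<union> (Q \<union> Q')) < card S" .
  then have "(\<Sum>V\<in>Pow S. (-1) ^ card V * balance i (card S) (card V)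
       * E (cell (V \<union> (P \<union> P')) (S - V \<union> (Q \<union> Q')))) = 0"
    using PQ low_cell by (intro balance_relation[OF S i]) auto
  moreover have "(\<lambda>y. cell (V \<union> P) (S - V \<union> Q) y * cell P' Q' y) = cell (V \<union> (P \<union> P')) (S - V \<union> (Q \<union> Q'))" for V
    by (simp add: cell_mult Un_assoc)
  ultimately show ?case by simp
next
  case (low_add f g)
  have "E (\<lambda>y. cell A B y * (f y + g y)) = E (\<lambda>y. cell A B y * f y) + E (\<lambda>y. cell A B y * g y)" for A B
    unfolding E_add[symmetric] by (rule E_cong) (simp add: algebra_simps)
  with low_add show ?case by (simp add: distrib_left sum.distrib)
next
  case (low_scale f c)
  have e: "E (\<lambda>y. cell A B y * (c * f y)) = c * E (\<lambda>y. cell A B y * f y)" for A B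
    unfolding E_cmult[symmetric] by (rule E_cong) (simp add: algebra_simps)
  have "(\<Sum>V\<in>Pow S. (-1) ^ card V * balance i (card S) (card V) * E (\<lambda>y. cell (V \<union> P) (S - V \<union> Q) y * (c * f y)))
     = c * (\<Sum>V\<in>Pow S. (-1) ^ card V * balance i (card S) (card V) * E (\<lambda>y. cell (V \<union> P) (S - V \<union> Q) y * f y))"
    unfolding e sum_distrib_left by (intro sum.cong) (simp_all add: algebra_simps)
  with low_scale show ?case by simp
qed simp

text \<open>The test cells are bounded row by row: a cell that becomes too large by one literal then
  has exactly \<open>s\<close> sites in a single row, the situation that
  \<open>balance_relation_low\<close> handles.\<close>

definition controlled :: "nat \<Rightarrow> real \<Rightarrow> ((nat \<times> nat) set \<Rightarrow> real) \<Rightarrow> bool" where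
  "controlled s B f \<longleftrightarrow> (\<forall>P Q. P \<subseteq> sites \<longrightarrow> Q \<subseteq> sites \<longrightarrow> (\<forall>i\<in>{1..n}. row_count i (P \<union> Q) < s)
      \<longrightarrow> \<bar>E (\<lambda>y. cell P Q y * f y)\<bar> \<le> B)"

lemma controlledD:
  "controlled s B f \<Longrightarrow> P \<subseteq> sites \<Longrightarrow> Q \<subseteq> sites \<Longrightarrow> (\<And>i. i \<in> {1..n} \<Longrightarrow> row_count i (P \<union> Q) < s)
    \<Longrightarrow> \<bar>E (\<lambda>y. cell P Q y * f y)\<bar> \<le> B"
  unfolding controlled_def by blast

lemma controlled_lin:
  assumes "controlled s B f" "controlled s B g" "\<bar>a\<bar> \<le> R" "\<bar>b\<bar> \<le> R" "0 \<le> B"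
  shows "controlled s (2 * R * B) (\<lambda>y. a * f y + b * g y)"
  unfolding controlled_def
proof (intro allI impI)
  fix P Q assume PQ: "P \<subseteq> sites" "Q \<subseteq> sites" "\<forall>i\<in>{1..n}. row_count i (P \<union> Q) < s"
  let ?f = "E (\<lambda>y. cell P Q y * f y)" and ?g = "E (\<lambda>y. cell P Q y * g y)"
  have "E (\<lambda>y. cell P Q y * (a * f y + b * g y)) = a * ?f + b * ?g"
  proof -
    have "E (\<lambda>y. cell P Q y * (a * f y + b * g y)) = E (\<lambda>y. a * (cell P Q y * f y) + b * (cell P Q y * g y))"
      by (rule E_cong) (simp add: algebra_simps)
    then show ?thesis by (simp only: E_add E_cmult)
  qed
  moreover have "\<bar>?f\<bar> \<le> B" "\<bar>?g\<bar> \<le> B" using assms(1,2) PQ by (auto intro!: controlledD)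
  then have "\<bar>a * ?f\<bar> \<le> R * B" "\<bar>b * ?g\<bar> \<le> R * B"
    unfolding abs_mult using assms(3-5) by (auto intro!: mult_mono)
  ultimately show "\<bar>E (\<lambda>y. cell P Q y * (a * f y + b * g y))\<bar> \<le> 2 * R * B" by linarith
qed

text \<open>If row \<open>i\<close> carries exactly \<open>s\<close> literals, vary their signs over
  all \<open>2 ^ s\<close> patterns with the rest fixed. Lowness of \<open>f\<close> gives the
  balance and control of \<open>f\<close> gives the step bound for
  \<open>alternating_balance\<close>.\<close>

lemma controlled_extended_cell:
  assumes low: "low s f" and con: "controlled s B f" and B: "0 \<le> B" and s: "0 < s"
    and k: "real s < k i + 1" "real s < real t - k i + 1" and i: "i \<in> {1..n}"
    and PQ: "P \<subseteq> sites" "Q \<subseteq> sites" "row_count i (P \<union> Q) \<le> s"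
      "\<And>j. j \<in> {1..n} \<Longrightarrow> j \<noteq> i \<Longrightarrow> row_count j (P \<union> Q) < s"
  shows "\<bar>E (\<lambda>y. cell P Q y * f y)\<bar> \<le> 2 * real s * B"
proof -
  have B': "B \<le> 2 * real s * B" using B s mult_right_mono[of 1 "2 * real s" B] by simp
  consider "P \<inter> Q \<noteq> {}" | "row_count i (P \<union> Q) < s" | "P \<inter> Q = {}" "row_count i (P \<union> Q) = s"
    using PQ by linarith
  then show ?thesis
  proof cases
    case 1
    then show ?thesis using B s by (simp add: cell_overlap)
  next
    case 2
    then have "\<bar>E (\<lambda>y. cell P Q y * f y)\<bar> \<le> B" 

      using PQ by (intro controlledD[OF con]) (metis+)
    then show ?thesis using B' by simp
  next
    case 3
    have fin: "finite P" "finite Q" using PQ finite_subset_sites by auto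
    define S where "S = (P \<union> Q) \<inter> ({i} \<times> UNIV)"
    have finS: "finite S" using fin by (auto simp: S_def)
    have S: "S \<subseteq> {i} \<times> {..<t}" using PQ by (auto simp: S_def sites_def)
    have "row_count i S = row_count i (P \<union> Q)"
      unfolding row_count_def S_def by (auto intro!: arg_cong[of _ _ card])
    then have card_S: "card S = s" using 3 row_count_within_row[of S i] S by force
    define P1 Q1 where "P1 = P - S" and "Q1 = Q - S"
    have none: "{b. (i, b) \<in> P1 \<union> Q1} = {}" by (auto simp: P1_def Q1_def S_def)
    define e where "e V = E (\<lambda>y. cell (V \<union> P1) (S - V \<union> Q1) y * f y)" for V
    have "\<bar>e (P \<inter> S)\<bar> \<le> 2 * real (card S) * B"
    proof (rule alternating_balance[where g = "\<lambda>V. balance i (card S) (card V)"])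
      show "0 < balance i (card S) (card V)" if "V \<subseteq> S" for V
        using k that finS by (intro balance_pos) (auto simp: card_S[symmetric] intro: card_mono)
      show "(\<Sum>V\<in>Pow S. (- 1) ^ card V * balance i (card S) (card V) * e V) = 0"
        unfolding e_def using low PQ S i none card_S
        by (intro balance_relation_low) (simp_all add: row_count_def, auto simp: P1_def Q1_def)
      fix V a assume V: "V \<subseteq> S" "a \<in> S - V"
      \<comment> \<open>Cells that differ only in the sign at \<open>a\<close> add up to the cell
        that ignores \<open>a\<close>, which has \<open>s - 1\<close> literals in row
        \<open>i\<close>.\<close>
      let ?Q = "S - V - {a} \<union> Q1"
      have "e V + e (insert a V) = E (\<lambda>y. cell (V \<union> P1) ?Q y * f y)"
      proof -
        have "insert a ?Q = S - V \<union> Q1" "S - insert a V = S - V - {a}" using V by auto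
        then have "cell (V \<union> P1) ?Q y = cell (insert a V \<union> P1) (S - insert a V \<union> Q1) y
              + cell (V \<union> P1) (S - V \<union> Q1) y" for y
          using cell_split[of "V \<union> P1" ?Q y a] by simp
        then show ?thesis
          unfolding e_def E_add[symmetric] by (intro E_cong) (simp add: algebra_simps)
      qed
      also have "\<bar>\<dots>\<bar> \<le> B"
      proof -
        have sub: "V \<union> P1 \<union> ?Q \<subseteq> P \<union> Q" using V by (auto simp: S_def P1_def Q1_def)
        have "row_count i (V \<union> P1 \<union> ?Q) = row_count i (S - {a})"
          unfolding row_count_def using none V by (auto intro!: arg_cong[of _ _ card])
        also have "\<dots> = card (S - {a})" using S by (intro row_count_within_row) auto
        also have "\<dots> < s" using V finS card_S by (metis DiffD1 card_Diff1_less)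
        finally have "\<forall>j\<in>{1..n}. row_count j (V \<union> P1 \<union> ?Q) < s"
          using PQ(4) order_le_less_trans[OF row_count_mono[OF _ sub]] fin by (metis finite_UnI)
        moreover have "V \<union> P1 \<subseteq> sites" "?Q \<subseteq> sites" using sub PQ(1,2) by auto
        ultimately show ?thesis using con unfolding controlled_def by blast
      qed
      finally show "\<bar>e V + e (insert a V)\<bar> \<le> B" .
    qed (use finS B in auto)
    moreover have "P \<inter> S \<union> P1 = P" "S - P \<inter> S \<union> Q1 = Q"
      using 3(1) by (auto simp: P1_def Q1_def S_def)
    ultimately show ?thesis unfolding e_def card_S by simp
  qed
qed

text \<open>The factor lives on one site, so only the row of that site gains a literal, and at most
  one.\<close>

lemma controlled_cell_mult:
  assumes low: "low s f" and con: "controlled s B f" and B: "0 \<le> B" and s: "0 < s"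
    and k: "\<And>i. i \<in> {1..n} \<Longrightarrow> real s < k i + 1 \<and> real s < real t - k i + 1"
    and e: "e \<in> sites" "P1 \<union> Q1 \<subseteq> {e}"
  shows "controlled s (2 * real s * B) (\<lambda>y. cell P1 Q1 y * f y)"
  unfolding controlled_def
proof (intro allI impI)
  fix P Q assume PQ: "P \<subseteq> sites" "Q \<subseteq> sites" "\<forall>i\<in>{1..n}. row_count i (P \<union> Q) < s"
  obtain i b where ib: "e = (i, b)" by fastforce
  have i: "i \<in> {1..n}" using e ib by (auto simp: sites_def)
  have fin: "finite P" "finite Q" using PQ finite_subset_sites by auto
  have "row_count j ((P \<union> P1) \<union> (Q \<union> Q1)) \<le> row_count j (insert e (P \<union> Q))" for j
    using fin e by (intro row_count_mono) auto
  moreover have "row_count j (insert e (P \<union> Q)) \<le> (if j = i then Suc (row_count j (P \<union> Q)) else row_count j (P \<union> Q))" for j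
    using row_count_insert[of "P \<union> Q" i b j] fin ib
    by (cases "e \<in> P \<union> Q") (simp_all add: insert_absorb)
  ultimately have le: "row_count j ((P \<union> P1) \<union> (Q \<union> Q1)) \<le> (if j = i then Suc (row_count j (P \<union> Q)) else row_count j (P \<union> Q))" for j
    by (rule order_trans)
  have "\<bar>E (\<lambda>y. cell (P \<union> P1) (Q \<union> Q1) y * f y)\<bar> \<le> 2 * real s * B"
  proof (rule controlled_extended_cell[OF low con B s _ _ i])
    show "real s < k i + 1" "real s < real t - k i + 1" using k[OF i] by auto
    show "P \<union> P1 \<subseteq> sites" "Q \<union> Q1 \<subseteq> sites" using PQ e by auto
    show "row_count i ((P \<union> P1) \<union> (Q \<union> Q1)) \<le> s" using le[of i] PQ(3) i by fastforce
    show "row_count j ((P \<union> P1) \<union> (Q \<union> Q1)) < s" if "j \<in> {1..n}" "j \<noteq> i" for j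
      using le[of j] PQ(3) that by fastforce
  qed
  then show "\<bar>E (\<lambda>y. cell P Q y * (cell P1 Q1 y * f y))\<bar> \<le> 2 * real s * B"
    by (simp add: cell_mult flip: mult.assoc)
qed

end

section \<open>Evaluation of polynomials and restrictions\<close>

lemma poly_mapping_add_induct [case_names zero add]:
  assumes "P 0" "\<And>m c f. P f \<Longrightarrow> P (Poly_Mapping.single m c + f)"
  shows "P (p :: 'a \<Rightarrow>\<^sub>0 'b::ab_group_add)"
proof (induction p rule: update_induct)
  case const
  then show ?case using assms by simp
next
  case (update f a b)
  have "Poly_Mapping.update a b f = Poly_Mapping.single a b + f"
    using update by (intro poly_mapping_eqI) (auto simp: lookup_update lookup_add lookup_single in_keys_iff when_def)
  then show ?case using assms update by simp
qed

definition mon_val :: "('v \<Rightarrow> real) \<Rightarrow> ('v \<Rightarrow>\<^sub>0 nat) \<Rightarrow> real" where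
  "mon_val \<theta> m = (\<Prod>v\<in>Poly_Mapping.keys m. \<theta> v ^ Poly_Mapping.lookup m v)"

definition poly_val :: "('v \<Rightarrow> real) \<Rightarrow> (('v \<Rightarrow>\<^sub>0 nat) \<Rightarrow>\<^sub>0 rat) \<Rightarrow> real" where
  "poly_val \<theta> p = (\<Sum>m\<in>Poly_Mapping.keys p. of_rat (Poly_Mapping.lookup p m) * mon_val \<theta> m)"

lemma mon_val_superset:
  "finite K \<Longrightarrow> Poly_Mapping.keys m \<subseteq> K \<Longrightarrow> mon_val \<theta> m = (\<Prod>v\<in>K. \<theta> v ^ Poly_Mapping.lookup m v)"
  unfolding mon_val_def by (rule prod.mono_neutral_left) (auto simp: in_keys_iff)

lemma mon_val_add: "mon_val \<theta> (m + m') = mon_val \<theta> m * mon_val \<theta> m'"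
proof -
  let ?K = "Poly_Mapping.keys m \<union> Poly_Mapping.keys m'"
  have "Poly_Mapping.keys (m + m') \<subseteq> ?K" by (rule keys_add)
  then show ?thesis
    by (simp add: mon_val_superset[of ?K] lookup_add power_add prod.distrib)
qed

lemma poly_val_superset:
  "finite K \<Longrightarrow> Poly_Mapping.keys p \<subseteq> K \<Longrightarrow> poly_val \<theta> p = (\<Sum>m\<in>K. of_rat (Poly_Mapping.lookup p m) * mon_val \<theta> m)"
  unfolding poly_val_def by (rule sum.mono_neutral_left) (auto simp: in_keys_iff)

lemma poly_val_0 [simp]: "poly_val \<theta> 0 = 0"
  by (simp add: poly_val_def)

lemma poly_val_add: "poly_val \<theta> (p + q) = poly_val \<theta> p + poly_val \<theta> q"
proof -
  let ?K = "Poly_Mapping.keys p \<union> Poly_Mapping.keys q"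
  have "Poly_Mapping.keys (p + q) \<subseteq> ?K" by (rule keys_add)
  then show ?thesis
    by (simp add: poly_val_superset[of ?K] lookup_add of_rat_add algebra_simps sum.distrib)
qed

lemma poly_val_diff: "poly_val \<theta> (p - q) = poly_val \<theta> p - poly_val \<theta> q"
  using poly_val_add[of \<theta> "p - q" q] by simp

lemma poly_val_sum: "poly_val \<theta> (\<Sum>a\<in>A. f a) = (\<Sum>a\<in>A. poly_val \<theta> (f a))"
  by (induction A rule: infinite_finite_induct) (simp_all add: poly_val_add)

lemma poly_val_single: "poly_val \<theta> (Poly_Mapping.single m c) = of_rat c * mon_val \<theta> m"
  using poly_val_superset[of "{m}" "Poly_Mapping.single m c" \<theta>] by simp

lemma poly_val_single_mult:
  "poly_val \<theta> (Poly_Mapping.single m c * q) = of_rat c * mon_val \<theta> m * poly_val \<theta> q"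
  by (induction q rule: poly_mapping_add_induct)
     (simp_all add: distrib_left poly_val_add mult_single poly_val_single mon_val_add of_rat_mult)

lemma poly_val_mult: "poly_val \<theta> (p * q) = poly_val \<theta> p * poly_val \<theta> q"
  by (induction p rule: poly_mapping_add_induct)
     (simp_all add: distrib_right poly_val_add poly_val_single_mult poly_val_single)

lemma poly_val_PVar: "poly_val \<theta> (PVar v) = \<theta> v"
  by (simp add: PVar_def poly_val_single mon_val_def)

lemma poly_val_PConst: "poly_val \<theta> (PConst c) = of_rat c"
  by (simp add: PConst_def poly_val_single mon_val_def)

lemma poly_val_1: "poly_val \<theta> 1 = 1"
  using poly_val_single[of \<theta> 0 1] by (simp add: mon_val_def)

section \<open>Restrictions that kill wide monomials\<close>

text \<open>Union bound: a uniformly random \<open>\<rho>\<close> misses all targets of one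
  \<open>m\<close> with probability at most \<open>(2/3) ^ s\<close>.\<close>

lemma exists_avoiding_restriction:
  assumes "finite I" "finite M" and T: "\<And>m. m \<in> M \<Longrightarrow> T m \<subseteq> I \<and> s \<le> card (T m)"
    and \<beta>: "\<And>m e. m \<in> M \<Longrightarrow> e \<in> T m \<Longrightarrow> \<beta> m e < (3::nat)" and few: "card M * 2 ^ s < (3::nat) ^ s"
  shows "\<exists>\<rho>\<in>I \<rightarrow> {..<3}. \<forall>m\<in>M. \<exists>e\<in>T m. \<rho> e = \<beta> m e"
proof (rule ccontr)
  assume contra: "\<not> ?thesis"
  define bad where "bad m = PiE I (\<lambda>e. if e \<in> T m then {..<3} - {\<beta> m e} else {..<3})" for m
  have "PiE I (\<lambda>_. {..<3}) \<subseteq> (\<Union>m\<in>M. bad m)"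
  proof
    fix \<rho> assume \<rho>: "\<rho> \<in> PiE I (\<lambda>_. {..<(3::nat)})"
    then obtain m where "m \<in> M" "\<forall>e\<in>T m. \<rho> e \<noteq> \<beta> m e" using contra by (auto simp: PiE_def)
    then show "\<rho> \<in> (\<Union>m\<in>M. bad m)" using \<rho> by (auto simp: bad_def PiE_def Pi_def)
  qed
  moreover have fin: "finite (bad m)" for m unfolding bad_def using assms by (intro finite_PiE) auto
  ultimately have "card (PiE I (\<lambda>_. {..<(3::nat)})) \<le> card (\<Union>m\<in>M. bad m)"
    using assms by (intro card_mono) auto
  then have "3 ^ card I \<le> card (\<Union>m\<in>M. bad m)" using assms by (simp add: card_PiE)
  also have "\<dots> \<le> (\<Sum>m\<in>M. card (bad m))" using assms by (intro card_UN_le)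
  \<comment> \<open>The factor \<open>3 ^ s\<close> keeps the probability estimate within the
    natural numbers.\<close>
  finally have "3 ^ s * 3 ^ card I \<le> (\<Sum>m\<in>M. 3 ^ s * card (bad m))"
    by (simp add: flip: sum_distrib_left)
  also have "\<dots> \<le> (\<Sum>m\<in>M. 2 ^ s * 3 ^ card I)"
  proof (rule sum_mono)
    fix m assume m: "m \<in> M"
    have fT: "finite (T m)" using T[OF m] assms finite_subset by blast
    have cT: "card (T m) \<le> card I" using T[OF m] assms by (intro card_mono) auto
    have "card (bad m) = (\<Prod>e\<in>I. if e \<in> T m then 2 else 3)"
      unfolding bad_def using assms \<beta>[OF m] by (subst card_PiE) (auto intro!: prod.cong)
    also have "\<dots> = 2 ^ card (T m) * 3 ^ (card I - card (T m))"
      using assms T[OF m] fT by (simp add: prod.If_cases Int_absorb1 card_Diff_subset Diff_eq[symmetric])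
    finally have "3 ^ s * card (bad m) = 3 ^ s * (2 ^ s * 2 ^ (card (T m) - s)) * 3 ^ (card I - card (T m))"
      using T[OF m] by (simp flip: power_add)
    also have "\<dots> \<le> 3 ^ s * (2 ^ s * 3 ^ (card (T m) - s)) * 3 ^ (card I - card (T m))"
      by (intro mult_mono power_mono) auto
    also have "\<dots> = 2 ^ s * (3 ^ s * 3 ^ (card (T m) - s) * 3 ^ (card I - card (T m)))" by simp
    also have "\<dots> = 2 ^ s * 3 ^ card I" using T[OF m] cT by (simp flip: power_add)
    finally show "3 ^ s * card (bad m) \<le> 2 ^ s * 3 ^ card I" .
  qed
  also have "\<dots> = card M * 2 ^ s * 3 ^ card I" by simp
  finally have "3 ^ s * 3 ^ card I \<le> card M * 2 ^ s * (3::nat) ^ card I" .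
  with few show False by simp
qed

text \<open>Columns are numbered from 1 and blocks from 0, hence \<open>j - 1\<close>. Twins share a
  block.\<close>

fun block :: "var \<Rightarrow> nat \<times> nat" where
  "block (X i j) = (i, (j - 1) div 3)"
| "block (Xbar i j) = (i, (j - 1) div 3)"

context pseudo_distribution
begin

text \<open>\<open>\<rho>\<close> rotates the pattern (free, 0, 1) within each block; variables outside the blocks are set to 0.\<close>
definition xval :: "(nat \<times> nat \<Rightarrow> nat) \<Rightarrow> (nat \<times> nat) set \<Rightarrow> nat \<Rightarrow> nat \<Rightarrow> real" where
  "xval \<rho> y i j = (let e = (i, (j - 1) div 3); r = (j - 1 + \<rho> e) mod 3 in
     if e \<in> sites then (if r = 0 then of_bool (e \<in> y) else if r = 1 then 0 else 1) else 0)"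

fun restrict_val :: "(nat \<times> nat \<Rightarrow> nat) \<Rightarrow> (nat \<times> nat) set \<Rightarrow> var \<Rightarrow> real" where
  "restrict_val \<rho> y (X i j) = xval \<rho> y i j"
| "restrict_val \<rho> y (Xbar i j) = 1 - xval \<rho> y i j"

text \<open>The value of \<open>\<rho>\<close> on the block of a literal that sets the literal to 0; modulo 3, \<open>2 * (j - 1)\<close>
  is the negative of \<open>j - 1\<close>.\<close>
fun killing_value :: "var \<Rightarrow> nat" where
  "killing_value (X i j) = (1 + 2 * (j - 1)) mod 3"
| "killing_value (Xbar i j) = (2 + 2 * (j - 1)) mod 3"

definition touched :: "(var \<Rightarrow>\<^sub>0 nat) \<Rightarrow> (nat \<times> nat) set" where
  "touched m = block ` Poly_Mapping.keys m \<inter> sites"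

lemma finite_touched [simp]: "finite (touched m)"
  by (simp add: touched_def)

lemma restrict_val_boolean: "restrict_val \<rho> y v = 0 \<or> restrict_val \<rho> y v = 1"
  by (cases v) (auto simp: xval_def Let_def)

lemma restrict_val_killed:
  assumes "block v \<in> sites" "\<rho> (block v) = killing_value v"
  shows "restrict_val \<rho> y v = 0"
proof (cases v)
  case (X i j)
  have r: "(a + (1 + 2 * a) mod 3) mod 3 = 1" for a :: nat by presburger
  have "(i, (j - 1) div 3) \<in> sites" "\<rho> (i, (j - 1) div 3) = (1 + 2 * (j - 1)) mod 3"
    using assms X by simp_all
  then show ?thesis unfolding X restrict_val.simps xval_def Let_def by (simp only: r) simp
next
  case (Xbar i j)
  \<comment> \<open>Residue 2 sets the variable to 1 and so its twin to 0; for \<open>X\<close> the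
    relevant residue is 1.\<close>
  have r: "(a + (2 + 2 * a) mod 3) mod 3 = 2" for a :: nat by presburger
  have "(i, (j - 1) div 3) \<in> sites" "\<rho> (i, (j - 1) div 3) = (2 + 2 * (j - 1)) mod 3"
    using assms Xbar by simp_all
  then show ?thesis unfolding Xbar restrict_val.simps xval_def Let_def by (simp only: r) simp
qed

text \<open>A restricted literal is 0, 1, or a literal on its own site; the coefficient
  \<open>c\<close> provides the value 0.\<close>

lemma restrict_val_cell:
  "\<exists>c P Q. \<bar>c\<bar> \<le> 1 \<and> P \<union> Q \<subseteq> {block v} \<inter> sites \<and> (\<forall>y. restrict_val \<rho> y v = c * cell P Q y)"
proof -
  let ?good = "\<lambda>c P Q. \<bar>c\<bar> \<le> 1 \<and> P \<union> Q \<subseteq> {block v} \<inter> sites \<and> (\<forall>y. restrict_val \<rho> y v = c * cell P Q y)"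
  obtain i j where v: "v = X i j \<or> v = Xbar i j" by (cases v) auto
  define e r where "e = (i, (j - 1) div 3)" and "r = (j - 1 + \<rho> e) mod 3"
  have e: "block v = e" using v by (auto simp: e_def)
  have x: "xval \<rho> y i j = (if e \<in> sites then (if r = 0 then of_bool (e \<in> y) else if r = 1 then 0 else 1) else 0)" for y
    by (simp add: xval_def e_def r_def)
  consider "\<forall>y. xval \<rho> y i j = 0" | "\<forall>y. xval \<rho> y i j = 1" | "e \<in> sites" "\<forall>y. xval \<rho> y i j = of_bool (e \<in> y)"
    using x by (cases "e \<in> sites"; cases "r = 0"; cases "r = 1") simp_all
  then have "(\<forall>y. restrict_val \<rho> y v = 0) \<or> (\<forall>y. restrict_val \<rho> y v = 1) \<or>
     (e \<in> sites \<and> (\<forall>y. restrict_val \<rho> y v = of_bool (e \<in> y))) \<or> 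
     (e \<in> sites \<and> (\<forall>y. restrict_val \<rho> y v = of_bool (e \<notin> y)))"
    using v by cases auto
  then have "?good 0 {} {} \<or> ?good 1 {} {} \<or> ?good 1 {e} {} \<or> ?good 1 {} {e}"
    unfolding e by (simp add: cell_def)
  then show ?thesis by blast
qed

lemma mon_val_cell:
  "\<exists>c P Q. P \<union> Q \<subseteq> touched m \<and> (\<forall>y. mon_val (restrict_val \<rho> y) m = c * cell P Q y)"
proof -
  have "\<exists>c P Q. P \<union> Q \<subseteq> block ` K \<inter> sites \<and> (\<forall>y. (\<Prod>v\<in>K. restrict_val \<rho> y v ^ Poly_Mapping.lookup m v) = c * cell P Q y)"
    if "finite K" "K \<subseteq> Poly_Mapping.keys m" for K
    using that
  proof (induction K rule: finite_induct)
    case empty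
    have "\<forall>y. (\<Prod>v\<in>{}. restrict_val \<rho> y v ^ Poly_Mapping.lookup m v) = 1 * cell {} {} y" by simp
    then show ?case by blast
  next
    case (insert v K)
    then obtain c P Q where 1: "P \<union> Q \<subseteq> block ` K \<inter> sites"
      "\<And>y. (\<Prod>v\<in>K. restrict_val \<rho> y v ^ Poly_Mapping.lookup m v) = c * cell P Q y" by auto
    obtain c' P' Q' where 2: "P' \<union> Q' \<subseteq> {block v} \<inter> sites" "\<And>y. restrict_val \<rho> y v = c' * cell P' Q' y"
      using restrict_val_cell[of v \<rho>] by auto
    \<comment> \<open>A positive power of a 0/1 value is that value, so exponents disappear.\<close>
    have "0 < Poly_Mapping.lookup m v" using insert by (auto simp: in_keys_iff)
    then have "restrict_val \<rho> y v ^ Poly_Mapping.lookup m v = restrict_val \<rho> y v" for y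
      using restrict_val_boolean[of \<rho> y v] by auto
    then have "(\<Prod>v\<in>insert v K. restrict_val \<rho> y v ^ Poly_Mapping.lookup m v) = (c' * c) * cell (P' \<union> P) (Q' \<union> Q) y" for y
      using insert 1(2)[of y] by (simp add: 2(2) flip: cell_mult)
    moreover have "(P' \<union> P) \<union> (Q' \<union> Q) \<subseteq> block ` insert v K \<inter> sites" using 1(1) 2(1) by auto
    ultimately show ?case by blast
  qed
  from this[of "Poly_Mapping.keys m"] show ?thesis by (simp add: mon_val_def touched_def)
qed

lemma exists_killing_restriction:
  assumes "finite M" "card M * 2 ^ s < (3::nat) ^ s"
  shows "\<exists>\<rho>\<in>sites \<rightarrow> {..<3}. \<forall>m\<in>M. card (touched m) < s \<or> (\<forall>y. mon_val (restrict_val \<rho> y) m = 0)"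
proof -
  define M' where "M' = {m \<in> M. s \<le> card (touched m)}"
  \<comment> \<open>From each touched block one literal of the monomial is selected; hitting its
    killing value makes the whole product vanish.\<close>
  have "\<forall>m e. \<exists>v. e \<in> touched m \<longrightarrow> v \<in> Poly_Mapping.keys m \<and> block v = e" by (auto simp: touched_def)
  then obtain w where w: "\<And>m e. e \<in> touched m \<Longrightarrow> w m e \<in> Poly_Mapping.keys m \<and> block (w m e) = e" by metis
  have "killing_value v < 3" for v by (cases v) auto
  moreover have "card M' * 2 ^ s < 3 ^ s"
    using assms card_mono[of M M'] by (auto simp: M'_def intro: order_le_less_trans[OF mult_right_mono])
  ultimately obtain \<rho> where \<rho>: "\<rho> \<in> sites \<rightarrow> {..<3}" "\<And>m. m \<in> M' \<Longrightarrow> \<exists>e\<in>touched m. \<rho> e = killing_value (w m e)"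
    using exists_avoiding_restriction[of sites M' touched s "\<lambda>m e. killing_value (w m e)"] assms
    by (auto simp: M'_def touched_def)
  have "mon_val (restrict_val \<rho> y) m = 0" if m: "m \<in> M'" for m y
  proof -
    obtain e where e: "e \<in> touched m" "\<rho> e = killing_value (w m e)" using \<rho>(2)[OF m] by blast
    then have "restrict_val \<rho> y (w m e) = 0"
      using w[OF e(1)] by (intro restrict_val_killed) (auto simp: touched_def)
    moreover have "w m e \<in> Poly_Mapping.keys m" "Poly_Mapping.lookup m (w m e) \<noteq> 0"
      using w[OF e(1)] by (auto simp: in_keys_iff)
    ultimately show ?thesis unfolding mon_val_def by (intro prod_zero) (auto intro!: bexI[of _ "w m e"])
  qed
  then show ?thesis using \<rho>(1) by (intro bexI[of _ \<rho>]) (auto simp: M'_def not_le)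
qed

lemma sum_lessThan_triple: "sum f {..<3 * t} = (\<Sum>b<t. f (3 * b) + f (3 * b + 1) + (f (3 * b + 2) :: real))"
  by (induction t) (simp_all add: eval_nat_numeral add_ac)

lemma xval_site:
  assumes "(i, b) \<in> sites" "p < 3"
  shows "xval \<rho> y i (Suc (3 * b + p)) = (if (p + \<rho> (i, b)) mod 3 = 0 then of_bool ((i, b) \<in> y)
     else if (p + \<rho> (i, b)) mod 3 = 1 then 0 else 1)"
proof -
  have "(3 * b + p) div 3 = b" using assms by presburger
  moreover have "(3 * b + p + \<rho> (i, b)) mod 3 = (p + \<rho> (i, b)) mod 3" by presburger
  ultimately show ?thesis using assms unfolding xval_def Let_def by simp
qed

text \<open>Each block contributes a fixed 1 and its free bit; the columns left over after
  \<open>t\<close> full blocks contribute 0.\<close>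

lemma poly_val_ks:
  assumes \<rho>: "\<rho> \<in> sites \<rightarrow> {..<3}" and i: "i \<in> {1..n}" and y: "y \<subseteq> sites" and t: "t = 2 * n div 3"
  shows "poly_val (restrict_val \<rho> y) (ks n i) = real t + real (row_count i y) - real n"
proof -
  have "(\<Sum>j\<in>{1..2*n}. xval \<rho> y i j) = (\<Sum>j<2*n. xval \<rho> y i (Suc j))"
    by (rule sum.reindex_bij_witness[of _ Suc "\<lambda>j. j - 1"]) auto
  also have "\<dots> = (\<Sum>j<3*t. xval \<rho> y i (Suc j))"
  proof (rule sum.mono_neutral_right)
    show "\<forall>j\<in>{..<2 * n} - {..<3 * t}. xval \<rho> y i (Suc j) = 0"
    proof
      fix j assume "j \<in> {..<2 * n} - {..<3 * t}"
      then have "\<not> j div 3 < t" by auto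
      then show "xval \<rho> y i (Suc j) = 0" by (simp add: xval_def sites_def)
    qed
  qed (use t in auto)
  also have "\<dots> = (\<Sum>b<t. 1 + of_bool ((i, b) \<in> y))"
    unfolding sum_lessThan_triple
  proof (rule sum.cong)
    fix b assume "b \<in> {..<t}"
    then have e: "(i, b) \<in> sites" using i by (auto simp: sites_def)
    then have "\<rho> (i, b) < 3" using \<rho> by auto
    then have "\<rho> (i, b) = 0 \<or> \<rho> (i, b) = 1 \<or> \<rho> (i, b) = 2" by linarith
    then show "xval \<rho> y i (Suc (3 * b)) + xval \<rho> y i (Suc (3 * b + 1)) + xval \<rho> y i (Suc (3 * b + 2))
       = 1 + of_bool ((i, b) \<in> y)"
      using xval_site[OF e, of 0 \<rho> y] xval_site[OF e, of 1 \<rho> y] xval_site[OF e, of 2 \<rho> y] by auto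
  qed simp
  also have "\<dots> = real t + real (row_count i y)"
    using row_count_eq_sum[OF y, of i] by (simp add: sum.distrib)
  finally have "(\<Sum>j\<in>{1..2*n}. xval \<rho> y i j) = real t + real (row_count i y)" .
  moreover have "poly_val (restrict_val \<rho> y) (ks n i) = (\<Sum>j\<in>{1..2*n}. xval \<rho> y i j) - real n"
    unfolding ks_def poly_val_diff poly_val_sum poly_val_PVar poly_val_PConst restrict_val.simps of_rat_of_nat_eq ..
  ultimately show ?thesis by (simp only:)
qed

end

section \<open>Propagation along a proof\<close>

lemma line_height_Mult: "snd (P ! i) = Mult v j \<Longrightarrow> j < i \<Longrightarrow> line_height P i = Suc (line_height P j)"
  by (subst line_height.simps) simp

lemma line_height_Lin: "snd (P ! i) = Lin a j b l \<Longrightarrow> j < i \<Longrightarrow> l < i \<Longrightarrow>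
    line_height P i = Suc (max (line_height P j) (line_height P l))"
  by (subst line_height.simps) simp

context pseudo_distribution
begin

lemma poly_val_low:
  assumes "\<And>m. m \<in> Poly_Mapping.keys p \<Longrightarrow> card (touched m) < s \<or> (\<forall>y. mon_val (restrict_val \<rho> y) m = 0)"
  shows "low s (\<lambda>y. poly_val (restrict_val \<rho> y) p)"
  unfolding poly_val_def
proof (intro low_sum low_scale)
  fix m assume m: "m \<in> Poly_Mapping.keys p"
  show "low s (\<lambda>y. mon_val (restrict_val \<rho> y) m)"
  proof (cases "card (touched m) < s")
    case True
    obtain c P Q where PQ: "P \<union> Q \<subseteq> touched m" and val: "\<And>y. mon_val (restrict_val \<rho> y) m = c * cell P Q y"
      using mon_val_cell[of m \<rho>] by auto
    have "card (P \<union> Q) \<le> card (touched m)" using PQ by (intro card_mono) auto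
    then have "low s (cell P Q)" using True PQ by (intro low_cell) (auto simp: touched_def)
    then show ?thesis unfolding val by (rule low_scale)
  next
    case False
    then show ?thesis using assms[OF m] low_zero by simp
  qed
qed

lemma controlled_mono: "controlled s B f \<Longrightarrow> B \<le> B' \<Longrightarrow> controlled s B' f"
  unfolding controlled_def using order_trans by blast

lemma controlled_0: "0 \<le> B \<Longrightarrow> (\<And>y. y \<subseteq> sites \<Longrightarrow> f y = 0) \<Longrightarrow> controlled s B f"
  unfolding controlled_def using E_cong[of "\<lambda>y. cell P Q y * f y" "\<lambda>y. 0" for P Q] by simp

lemma controlled_restrict_val:
  assumes low: "low s f" and con: "controlled s B f" and B: "0 \<le> B" and s: "0 < s"
    and k: "\<And>i. i \<in> {1..n} \<Longrightarrow> real s < k i + 1 \<and> real s < real t - k i + 1"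
    and nonempty: "sites \<noteq> {}"
  shows "controlled s (2 * real s * B) (\<lambda>y. restrict_val \<rho> y v * f y)"
proof -
  obtain c P1 Q1 where c: "\<bar>c\<bar> \<le> 1" "P1 \<union> Q1 \<subseteq> {block v} \<inter> sites" "\<And>y. restrict_val \<rho> y v = c * cell P1 Q1 y"
    using restrict_val_cell[of v \<rho>] by auto
  \<comment> \<open>If the literal became constant, its cell is empty and any site can serve as
    \<open>e\<close>.\<close>
  obtain e where e: "e \<in> sites" "P1 \<union> Q1 \<subseteq> {e}" using c(2) nonempty by blast
  have "controlled s (2 * real s * B) (\<lambda>y. cell P1 Q1 y * f y)"
    by (rule controlled_cell_mult[OF low con B s k e])
  then show ?thesis unfolding controlled_def
  proof (elim all_forward imp_forward)
    fix P Q assume le: "\<bar>E (\<lambda>y. cell P Q y * (cell P1 Q1 y * f y))\<bar> \<le> 2 * real s * B"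
    have "E (\<lambda>y. cell P Q y * (restrict_val \<rho> y v * f y)) = c * E (\<lambda>y. cell P Q y * (cell P1 Q1 y * f y))"
      unfolding E_cmult[symmetric] by (rule E_cong) (simp add: c(3))
    then show "\<bar>E (\<lambda>y. cell P Q y * (restrict_val \<rho> y v * f y))\<bar> \<le> 2 * real s * B"
      using mult_mono[OF c(1) le] by (simp add: abs_mult)
  qed
qed

text \<open>With fewer than \<open>s\<close> literals per row, \<open>phi\<close> stays in the range
  where it lies between 0 and 1.\<close>

lemma abs_E_cell_le_1:
  assumes "P \<subseteq> sites" "Q \<subseteq> sites" "\<And>i. i \<in> {1..n} \<Longrightarrow> row_count i (P \<union> Q) < s"
    and k: "\<And>i. i \<in> {1..n} \<Longrightarrow> real s < k i + 1 \<and> real s < real t - k i + 1"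
  shows "\<bar>E (cell P Q)\<bar> \<le> 1"
proof (cases "P \<inter> Q = {}")
  case True
  have fin: "finite P" "finite Q" using assms finite_subset_sites by auto
  have "real (row_count i P) \<le> k i \<and> real (row_count i Q) \<le> real t - k i \<and> row_count i P + row_count i Q \<le> t" if "i \<in> {1..n}" for i
  proof -
    have "row_count i P + row_count i Q < s" "row_count i (P \<union> Q) \<le> t"
      using assms(1-3) that fin True row_count_le[of "P \<union> Q" i] by (auto simp: row_count_Un_disjoint)
    then show ?thesis using k[OF that] fin True by (auto simp: row_count_Un_disjoint)
  qed
  then have "0 \<le> weight P Q \<and> weight P Q \<le> 1" by (rule weight_range)
  then show ?thesis using E_cell[OF assms(1,2) True] by simp
qed (simp add: cell_overlap E_def)

lemma E_cell_row_count_shift: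
  assumes "P \<subseteq> sites" "Q \<subseteq> sites" "i \<in> {1..n}" "Suc (row_count i (P \<union> Q)) < t"
  shows "E (\<lambda>y. cell P Q y * (real (row_count i y) + a)) = (k i + a) * E (cell P Q)"
    and "E (\<lambda>y. cell P Q y * (real (row_count i y) + a)\<^sup>2) = (k i + a)\<^sup>2 * E (cell P Q)"
proof -
  let ?c = "cell P Q" and ?r = "\<lambda>y. real (row_count i y)"
  have 1: "E (\<lambda>y. ?c y * ?r y) = k i * E ?c" using assms by (intro E_cell_row_count) auto
  have 2: "E (\<lambda>y. ?c y * (?r y)\<^sup>2) = (k i)\<^sup>2 * E ?c" using assms by (rule E_cell_row_count_square)
  have "E (\<lambda>y. ?c y * (?r y + a)) = E (\<lambda>y. ?c y * ?r y) + a * E ?c"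
    unfolding E_cmult[symmetric] E_add[symmetric] by (rule E_cong) (simp add: algebra_simps)
  then show "E (\<lambda>y. ?c y * (?r y + a)) = (k i + a) * E ?c" using 1 by (simp add: algebra_simps)
  have "E (\<lambda>y. ?c y * (?r y + a)\<^sup>2) = E (\<lambda>y. ?c y * (?r y)\<^sup>2) + ((2 * a) * E (\<lambda>y. ?c y * ?r y) + a\<^sup>2 * E ?c)"
    unfolding E_cmult[symmetric] E_add[symmetric] by (rule E_cong) (simp add: power2_eq_square algebra_simps)
  then show "E (\<lambda>y. ?c y * (?r y + a)\<^sup>2) = (k i + a)\<^sup>2 * E ?c"
    using 1 2 by (simp add: power2_eq_square algebra_simps)
qed

end

section \<open>The parameters for the knapsack equations\<close>

text \<open>Starting from 1/2, repeated squaring prescribes \<open>(1/2) ^ (2 ^ (i - 1))\<close> for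
  row \<open>i\<close>. By \<open>poly_val_ks\<close> the restricted row polynomial is the row count
  plus \<open>t - n\<close>, and solving for the row count gives \<open>k_eq\<close>.\<close>

locale knapsack_distribution = pseudo_distribution +
  fixes s :: nat
  assumes n_pos: "1 \<le> n" and t_eq: "t = 2 * n div 3" and s_pos: "0 < s" and s_lt: "s < t"
    and k_eq: "i \<in> {1..n} \<Longrightarrow> k i = real n - real t + (1/2) ^ (2 ^ (i - 1))"
    and k_range: "i \<in> {1..n} \<Longrightarrow> real s < k i + 1 \<and> real s < real t - k i + 1"
begin

text \<open>Row counts and their squares average to the prescribed values inside every test cell. So
  the initial and the recursive equations average to 0, and the last one to
  \<open>(1/2) ^ (2 ^ n)\<close> times the mass of the cell.\<close>

lemma controlled_axiom:
  assumes p: "p \<in> Qn n" and \<rho>: "\<rho> \<in> sites \<rightarrow> {..<3}"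
  shows "controlled s ((1/2) ^ (2 ^ n)) (\<lambda>y. poly_val (restrict_val \<rho> y) p)"
proof -
  define a where "a = real t - real n"
  have ka: "k i + a = (1/2) ^ (2 ^ (i - 1))" if "i \<in> {1..n}" for i using k_eq[OF that] by (simp add: a_def)
  have ksval: "poly_val (restrict_val \<rho> y) (ks n i) = real (row_count i y) + a"
    if "i \<in> {1..n}" "y \<subseteq> sites" for i y
    using poly_val_ks[OF \<rho> that t_eq] by (simp add: a_def)
  have square: "((1/2) ^ (2 ^ (i - 1)))\<^sup>2 = (1/2::real) ^ (2 ^ i)" if "1 \<le> i" for i :: nat
    using that by (cases i) (simp_all add: power_mult[symmetric] mult.commute)
  consider "p = ks n 1 - PConst (1/2)" | i where "p = ks n i ^ 2 - ks n (i+1)" "i \<in> {1..n-1}" | "p = ks n n ^ 2"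
    using p by (auto simp: Qn_def)
  note p_cases = this
  show ?thesis unfolding controlled_def
  proof (intro allI impI)
    fix P Q assume PQ: "P \<subseteq> sites" "Q \<subseteq> sites" "\<forall>i\<in>{1..n}. row_count i (P \<union> Q) < s"
    have rc: "Suc (row_count i (P \<union> Q)) < t" if "i \<in> {1..n}" for i using PQ(3) that s_lt by fastforce
    note shift = E_cell_row_count_shift[OF PQ(1,2) _ rc, of _ a]
    from p_cases show "\<bar>E (\<lambda>y. cell P Q y * poly_val (restrict_val \<rho> y) p)\<bar> \<le> (1/2) ^ (2 ^ n)"
    proof cases
      case 1
      have i: "1 \<in> {1..n}" using n_pos by simp
      have "E (\<lambda>y. cell P Q y * poly_val (restrict_val \<rho> y) p)
          = E (\<lambda>y. cell P Q y * (real (row_count 1 y) + a)) + (-1/2) * E (cell P Q)"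
        unfolding E_cmult[symmetric] E_add[symmetric]
        by (rule E_cong) (simp only: 1 poly_val_diff ksval[OF i] poly_val_PConst of_rat_divide, simp add: algebra_simps)
      also have "\<dots> = 0" using shift(1)[OF i i] ka[OF i] by simp
      finally show ?thesis by simp
    next
      case (2 i)
      have i: "i \<in> {1..n}" "i + 1 \<in> {1..n}" using 2 by auto
      have "E (\<lambda>y. cell P Q y * poly_val (restrict_val \<rho> y) p)
          = E (\<lambda>y. cell P Q y * (real (row_count i y) + a)\<^sup>2) + (-1) * E (\<lambda>y. cell P Q y * (real (row_count (i+1) y) + a))"
        unfolding E_cmult[symmetric] E_add[symmetric]
        by (rule E_cong) (simp only: 2 poly_val_diff power2_eq_square poly_val_mult ksval i, simp add: algebra_simps)
      also have "\<dots> = 0" using shift(2)[OF i(1) i(1)] shift(1)[OF i(2) i(2)] ka[OF i(1)] ka[OF i(2)] square[of i] i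
        by simp
      finally show ?thesis by simp
    next
      case 3
      have i: "n \<in> {1..n}" using n_pos by simp
      have "E (\<lambda>y. cell P Q y * poly_val (restrict_val \<rho> y) p) = E (\<lambda>y. cell P Q y * (real (row_count n y) + a)\<^sup>2)"
        by (rule E_cong) (simp only: 3 power2_eq_square poly_val_mult ksval i)
      also have "\<dots> = (1/2) ^ (2 ^ n) * E (cell P Q)"
        unfolding shift(2)[OF i i] ka[OF i] using square[OF n_pos] by simp
      finally show ?thesis using abs_E_cell_le_1[OF PQ(1,2) _ k_range] PQ(3) by (simp add: abs_mult)
    qed
  qed
qed

text \<open>One \<open>\<rho>\<close> serves all lines, so all of them are low. Boolean and twin
  axioms vanish under it; a product costs \<open>2 * s\<close>, which is at most
  \<open>2 * R\<close>, and a linear combination costs \<open>2 * R\<close>. The exponent therefore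
  follows the height.\<close>

lemma controlled_line:
  assumes ref: "pcr_refutation n P" and bnd: "bounded R P" and R: "1 \<le> R" "real s \<le> R"
    and few: "finite (monomials P)" "card (monomials P) * 2 ^ s < (3::nat) ^ s"
  shows "\<exists>\<rho>. \<forall>i<length P. controlled s ((1/2) ^ (2 ^ n) * (2 * R) ^ line_height P i) (\<lambda>y. poly_val (restrict_val \<rho> y) (fst (P ! i)))"
proof -
  let ?\<epsilon> = "(1/2::real) ^ (2 ^ n)"
  obtain \<rho> where \<rho>: "\<rho> \<in> sites \<rightarrow> {..<3}"
    "\<And>m. m \<in> monomials P \<Longrightarrow> card (touched m) < s \<or> (\<forall>y. mon_val (restrict_val \<rho> y) m = 0)"
    using exists_killing_restriction[OF few] by blast
  let ?f = "\<lambda>i y. poly_val (restrict_val \<rho> y) (fst (P ! i))"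
  have low: "low s (?f i)" if "i < length P" for i
  proof (rule poly_val_low)
    fix m assume "m \<in> Poly_Mapping.keys (fst (P ! i))"
    then have "m \<in> monomials P" using that by (auto simp: monomials_def)
    then show "card (touched m) < s \<or> (\<forall>y. mon_val (restrict_val \<rho> y) m = 0)" by (rule \<rho>(2))
  qed
  have nonempty: "sites \<noteq> {}" using n_pos s_lt by (auto simp: sites_def)
  have B0: "0 \<le> ?\<epsilon> * (2 * R) ^ h" for h using R by simp
  have B_mono: "?\<epsilon> * (2 * R) ^ h \<le> ?\<epsilon> * (2 * R) ^ h'" if "h \<le> h'" for h h'
    using R that by (intro mult_left_mono power_increasing) auto
  have "controlled s (?\<epsilon> * (2 * R) ^ line_height P i) (?f i)" if "i < length P" for i
    using that
  proof (induction i rule: less_induct)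
    case (less i)
    have ok: "line_ok n P i" using ref less.prems by (auto simp: pcr_refutation_def)
    have IH: "controlled s (?\<epsilon> * (2 * R) ^ line_height P j) (?f j)" if "j < i" for j
      using less that by auto
    show ?case
    proof (cases "snd (P ! i)")
      case Axiom
      then have "controlled s ?\<epsilon> (?f i)" using ok \<rho> by (intro controlled_axiom) (simp_all add: line_ok_def)
      then show ?thesis by (rule controlled_mono) (use B_mono[of 0] in simp)
    next
      case (Boolean v)
      then have "?f i y = 0" for y
        using ok restrict_val_boolean[of \<rho> y v]
        by (auto simp: line_ok_def poly_val_diff poly_val_mult poly_val_PVar power2_eq_square)
      then show ?thesis using B0 by (intro controlled_0)
    next
      case (Twin a b)
      then have "?f i y = 0" for y
        using ok by (simp add: line_ok_def poly_val_diff poly_val_add poly_val_PVar poly_val_1)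
      then show ?thesis using B0 by (intro controlled_0)
    next
      case (Mult v j)
      then have j: "j < i" "\<And>y. ?f i y = restrict_val \<rho> y v * ?f j y"
        using ok by (auto simp: line_ok_def poly_val_mult poly_val_PVar)
      have "controlled s (2 * real s * (?\<epsilon> * (2 * R) ^ line_height P j)) (\<lambda>y. restrict_val \<rho> y v * ?f j y)"
        using j less.prems by (intro controlled_restrict_val low IH B0 s_pos k_range nonempty) auto
      then show ?thesis unfolding j(2)
      proof (rule controlled_mono)
        show "2 * real s * (?\<epsilon> * (2 * R) ^ line_height P j) \<le> ?\<epsilon> * (2 * R) ^ line_height P i"
          using mult_right_mono[OF R(2) B0[of "line_height P j"]] line_height_Mult[OF Mult j(1)]
          by (simp add: algebra_simps)
      qed
    next
      case (Lin a j b l)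
      then have jl: "j < i" "l < i" "\<And>y. ?f i y = of_rat a * ?f j y + of_rat b * ?f l y"
        using ok by (auto simp: line_ok_def poly_val_add poly_val_mult poly_val_PConst)
      let ?h = "max (line_height P j) (line_height P l)"
      have "P ! i \<in> set P" using less.prems by simp
      then have ab: "\<bar>real_of_rat a\<bar> \<le> R" "\<bar>real_of_rat b\<bar> \<le> R"
        using bnd Lin by (auto simp: bounded_def scalars_def dest!: bspec)
      have "controlled s (2 * R * (?\<epsilon> * (2 * R) ^ ?h)) (\<lambda>y. of_rat a * ?f j y + of_rat b * ?f l y)"
        using jl by (intro controlled_lin controlled_mono[OF IH] B_mono ab B0) auto
      then show ?thesis unfolding jl(3) line_height_Lin[OF Lin jl(1,2)] by (simp add: algebra_simps)
    qed
  qed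
  then show ?thesis by blast
qed

text \<open>The final line tested against the empty cell has expectation 1.\<close>

lemma height_bound:
  assumes ref: "pcr_refutation n P" and bnd: "bounded R P" and R: "1 \<le> R" "real s \<le> R"
    and few: "finite (monomials P)" "card (monomials P) * 2 ^ s < (3::nat) ^ s"
  shows "2 ^ (2 ^ n) \<le> (2 * R) ^ height P"
proof -
  obtain \<rho> where con: "\<And>i. i < length P \<Longrightarrow>
      controlled s ((1/2) ^ (2 ^ n) * (2 * R) ^ line_height P i) (\<lambda>y. poly_val (restrict_val \<rho> y) (fst (P ! i)))"
    using controlled_line[OF assms] by blast
  have P: "P \<noteq> []" "fst (P ! (length P - 1)) = 1" using ref by (auto simp: pcr_refutation_def last_conv_nth)
  then have "controlled s ((1/2) ^ (2 ^ n) * (2 * R) ^ height P) (\<lambda>y. 1)"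
    using con[of "length P - 1"] by (simp add: height_def poly_val_1 del: line_height.simps)
  from controlledD[OF this, of "{}" "{}"] have "1 \<le> (1/2) ^ (2 ^ n) * (2 * R) ^ height P"
    using s_pos E_1 by simp
  then show ?thesis by (simp add: field_simps power_divide)
qed

end

text \<open>It suffices that \<open>c < (3/2) ^ (n div 4)\<close>, and
  \<open>(3/2) ^ 2 = 9/4\<close> exceeds 2; from \<open>n = 100\<close> on, \<open>n div 8\<close>
  exceeds \<open>n / 20\<close>.\<close>

lemma card_times_power_less:
  assumes "100 \<le> n" "real c \<le> 2 powr (1/20 * real n)"
  shows "c * 2 ^ (n div 4) < (3::nat) ^ (n div 4)"
proof -
  define s q where "s = n div 4" and "q = n div 8"
  have "2 * q \<le> s" by (simp add: s_def q_def)
  have "1/20 * real n < real q" using assms unfolding q_def by linarith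
  then have "real c < 2 powr real q" using assms by (smt (verit) powr_less_mono)
  also have "\<dots> = 2 ^ q" by (simp add: powr_realpow)
  also have "\<dots> \<le> (9/4) ^ q" by (intro power_mono) auto
  also have "\<dots> = (3/2::real) ^ (2 * q)" by (simp add: power_mult power2_eq_square)
  also have "\<dots> \<le> (3/2) ^ s" using \<open>2 * q \<le> s\<close> by (intro power_increasing) auto
  finally have "real c * 2 ^ s < 3 ^ s" by (simp add: power_divide field_simps)
  then have "real (c * 2 ^ s) < real (3 ^ s)" by simp
  then show ?thesis unfolding s_def by linarith
qed

text \<open>With \<open>x = 2 powr (n / 2)\<close>, taking logarithms gives
  \<open>x * x \<le> (1 + x) * h\<close>, and \<open>1 + x \<le> 2 * x\<close>.\<close>

lemma height_ge_half:
  assumes "2 ^ (2 ^ n) \<le> (2 * 2 powr (2 powr (real n / 2))) ^ h"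
  shows "2 powr (real n / 2) / 2 \<le> real h"
proof -
  define x where "x = 2 powr (real n / 2)"
  have x: "1 \<le> x" unfolding x_def by (rule ge_one_powr_ge_zero) auto
  have "x * x = 2 powr real n" by (simp add: x_def flip: powr_add)
  then have xx: "x * x = 2 ^ n" by (simp add: powr_realpow)
  have "2 powr (x * x) = 2 powr real (2 ^ n)" by (simp add: xx)
  also have "\<dots> = 2 ^ (2 ^ n)" by (rule powr_realpow) simp
  also have "\<dots> \<le> (2 powr (1 + x)) ^ h" using assms by (simp add: x_def powr_add)
  also have "\<dots> = 2 powr ((1 + x) * real h)" by (simp add: powr_powr flip: powr_realpow)
  finally have "x * x \<le> (1 + x) * real h" by simp
  also have "\<dots> \<le> (2 * x) * real h" using x by (intro mult_right_mono) auto
  finally have "x * x \<le> x * (2 * real h)" by (simp add: mult_ac)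
  then have "x \<le> 2 * real h" using x by simp
  then show ?thesis by (simp add: x_def)
qed

theorem theorem10:
  shows "\<exists>c > (0::real). \<exists>d > (0::real). \<exists>N::nat. \<forall>n \<ge> N. \<forall>P.
     pcr_refutation n P \<and> bounded (2 powr (2 powr (real n / 2))) P
     \<and> real (card (monomials P)) \<le> 2 powr (d * real n)
     \<longrightarrow> real (height P) \<ge> 2 powr (real n / 2 - 2)
           - (c * real n + 2 * log 2 (real n)) / 2 powr (real n / 2 + 2) - 1"
proof (intro exI conjI allI impI)
  \<comment> \<open>The witnesses are \<open>c = 1\<close>, \<open>d = 1/20\<close> and, fixed by
    the assumption on \<open>n\<close> below, \<open>N = 100\<close>.\<close>
  show "(0::real) < 1" "(0::real) < 1/20" by simp_all
  fix n :: nat and P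
  assume n: "100 \<le> n"
  assume asm: "pcr_refutation n P \<and> bounded (2 powr (2 powr (real n / 2))) P
     \<and> real (card (monomials P)) \<le> 2 powr (1/20 * real n)"
  \<comment> \<open>Both \<open>k i\<close> and \<open>t - k i\<close> are close to
    \<open>n / 3\<close>, so \<open>n div 4\<close> meets \<open>k_range\<close> while growing
    linearly in \<open>n\<close>.\<close>
  define t s where "t = 2 * n div 3" and "s = n div 4"
  define k where "k i = real n - real t + (1/2) ^ (2 ^ (i - 1))" for i :: nat
  define R :: real where "R = 2 powr (2 powr (real n / 2))"
  interpret knapsack_distribution n t k s
  proof
    show "1 \<le> n" "0 < s" "s < t" using n unfolding s_def t_def by auto
    show "t = 2 * n div 3" by (rule t_def)
    fix i
    show "k i = real n - real t + (1/2) ^ (2 ^ (i - 1))" by (rule k_def)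
    have "(1/2::real) ^ (2 ^ (i - 1)) \<le> (1/2) ^ 1" by (intro power_decreasing) auto
    moreover have "0 < (1/2::real) ^ (2 ^ (i - 1))" by simp
    moreover have "3 * real t \<le> 2 * real n" "2 * real n \<le> 3 * real t + 2" "4 * real s \<le> real n"
      unfolding t_def s_def by linarith+
    moreover have "100 \<le> real n" using n by simp
    ultimately show "real s < k i + 1 \<and> real s < real t - k i + 1"
      unfolding power_one_right k_def by linarith
  qed
  \<comment> \<open>Used twice: from \<open>n / 2\<close> to \<open>2 powr (n / 2)\<close>, and from
    there to \<open>R\<close>, which shows that \<open>s \<le> R\<close>.\<close>
  have less_powr: "x < 2 powr x" if "0 \<le> x" for x :: real
  proof -
    obtain m where m: "m = nat \<lfloor>x\<rfloor>" by simp
    have "x < real (Suc m)" using that m by linarith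
    also have "real (Suc m) \<le> 2 ^ m" using Suc_leI[OF less_exp[of m]] by (metis of_nat_le_iff of_nat_numeral of_nat_power)
    also have "\<dots> = 2 powr real m" by (simp add: powr_realpow)
    also have "\<dots> \<le> 2 powr x" using that m by (intro powr_mono) linarith+
    finally show ?thesis .
  qed
  have "real s \<le> real n / 2" unfolding s_def by linarith
  also have "\<dots> < 2 powr (real n / 2)" by (rule less_powr) simp
  also have "\<dots> < R" unfolding R_def by (rule less_powr) simp
  finally have "real s \<le> R" by simp
  moreover have "1 \<le> R" unfolding R_def by (intro ge_one_powr_ge_zero) auto
  moreover have "finite (monomials P)" by (simp add: monomials_def)
  moreover have "card (monomials P) * 2 ^ s < 3 ^ s"
    using card_times_power_less[OF n] asm unfolding s_def by blast
  ultimately have "2 ^ (2 ^ n) \<le> (2 * R) ^ height P"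
    using asm by (intro height_bound) (auto simp: R_def)
  then have "2 powr (real n / 2) / 2 \<le> real (height P)" unfolding R_def by (rule height_ge_half)
  \<comment> \<open>The main term of the goal is a quarter of \<open>2 powr (n / 2)\<close>, below
    the half just obtained, and nonnegative terms are subtracted from it.\<close>
  moreover have "2 powr (real n / 2 - 2) = 2 powr (real n / 2) / 4" by (simp add: powr_diff)
  moreover have "0 \<le> 2 powr (real n / 2)" by simp
  moreover have "0 \<le> (1 * real n + 2 * log 2 (real n)) / 2 powr (real n / 2 + 2)"
    using n by (intro divide_nonneg_nonneg add_nonneg_nonneg) auto
  ultimately show "2 powr (real n / 2 - 2) - (1 * real n + 2 * log 2 (real n)) / 2 powr (real n / 2 + 2) - 1
      \<le> real (height P)" by linarith
qed

end
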